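(* Let $\nu>0$, $\epsilon>0$, $f\in X'$, and set $\kappa:=\nu^{-2}M\|f\|_{-1}$. For any $(u,p),(w,z)\in(X_h,Q_h)$, $$\|G(u,p)-G(w,z)\|_X\le C_L\,\|(u,p)-(w,z)\|_X,$$ where $C_L=\max\{1,\ \kappa+\sqrt{\epsilon/\nu^3}\,M\|p\|\}$.
   Context: $\Omega\subset\mathbb{R}^d$ ($d=2,3$) is open and connected with Lipschitz boundary; $(\cdot,\cdot)$ and $\|\cdot\|$ denote the $L^2(\Omega)$ inner product and norm (for scalar-, vector- or matrix-valued functions). $X=H_0^1(\Omega)$ ($\mathbb{R}^d$-valued), on which the Poincaré inequality $\|\phi\|\le C_P\|\nabla\phi\|$ holds; $Q=L^2_0(\Omega)$ is the space of scalar $L^2$ functions with zero mean. $X'$ is the dual of $X$, with norm $\|\cdot\|_{-1}$ dual to the norm $v\mapsto\|\nabla v\|$ on $X$, and $(f,v)$ denotes the duality pairing for $f\in X'$. $\tau_h$ is a conforming, shape-regular simplicial triangulation of $\Omega$, $X_h$ is the finite-dimensional subspace of $X$ of vector-valued globally continuous functions that are piecewise polynomial of a fixed degree on $\tau_h$, and $Q_h=\nabla\cdot X_h\subseteq Q$. No inf-sup condition on $(X_h,Q_h)$ is assumed. We write $(X_h,Q_h)$ for $X_h\times Q_h$. The trilinear form is $b^*(u,v,w)=\tfrac12(u\cdot\nabla v,w)-\tfrac12(u\cdot\nabla w,v)$ for $u,v,w\in X$, and $M>0$ is a constant (depending only on $\Omega$) such that $b^*(u,v,w)\le M\|\nabla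 u\|\|\nabla v\|\|\nabla w\|$ for all $u,v,w\in X$. The norm on $(X_h,Q_h)$ is $\|(v,q)\|_X:=\sqrt{\nu\|\nabla v\|^2+\epsilon\|q\|^2}$. The iterated penalty Picard operator $G:(X_h,Q_h)\to(X_h,Q_h)$, $G(u,p)=(G_1(u,p),G_2(u,p))$, is defined by: for all $(v,q)\in(X_h,Q_h)$, $$\nu(\nabla G_1(u,p),\nabla v)+b^*(u,G_1(u,p),v)-(G_2(u,p),\nabla\cdot v)=(f,v),$$ $$\epsilon(G_2(u,p),q)+(\nabla\cdot G_1(u,p),q)=\epsilon(p,q)$$ (this linear system has a unique solution for each $(u,p)$). *)

theory Defs
  imports "HOL-Analysis.Analysis"
begin

text \<open>
  Functions on \<open>\<Omega>\<close> are represented by total functions; only their restrictions to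
  \<open>\<Omega>\<close> (to its closure, for finite element functions) matter.  Elements of \<open>L\<^sup>2\<close> are
  represented by measurable functions, not by equivalence classes.  Scalar-, vector- and
  matrix-valued functions are treated uniformly; on \<open>real^'n^'n\<close> the inner product and norm are
  the Frobenius ones.
\<close>

type_synonym 'n sfield = "real^'n \<Rightarrow> real"
type_synonym 'n vfield = "real^'n \<Rightarrow> real^'n"
type_synonym 'n mfield = "real^'n \<Rightarrow> real^'n^'n"


section \<open>Domains and triangulations\<close>

text \<open>
  Near each boundary point the domain lies strictly above the graph, in some unit direction
  \<open>e\<close>, of a Lipschitz function of the variables orthogonal to \<open>e\<close>.
\<close>

definition lipschitz_boundary :: "(real^'n) set \<Rightarrow> bool" where
  "lipschitz_boundary \<Omega> \<longleftrightarrow>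
     (\<forall>x\<in>frontier \<Omega>. \<exists>r>0. \<exists>e L \<gamma>. norm e = 1 \<and> L-lipschitz_on {z. z \<bullet> e = 0} \<gamma> \<and>
        \<Omega> \<inter> ball x r = {y \<in> ball x r. \<gamma> (y - (y \<bullet> e) *\<^sub>R e) < y \<bullet> e})"

definition inradius :: "(real^'n) set \<Rightarrow> real" where
  "inradius T = Sup {r. 0 \<le> r \<and> (\<exists>x. cball x r \<subseteq> T)}"

text \<open>Conformity (two cells meet in a common, possibly empty, face) is part of the library
  notion \<open>triangulation\<close>.\<close>

definition conforming_simplicial_mesh :: "(real^'n) set \<Rightarrow> (real^'n) set set \<Rightarrow> bool" where
  "conforming_simplicial_mesh \<Omega> \<tau> \<longleftrightarrow>
     triangulation \<tau> \<and> (\<forall>T\<in>\<tau>. int CARD('n) simplex T) \<and> \<Union>\<tau> = closure \<Omega>"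

definition shape_regular :: "real \<Rightarrow> (real^'n) set set \<Rightarrow> bool" where
  "shape_regular \<sigma> \<tau> \<longleftrightarrow> (\<forall>T\<in>\<tau>. diameter T \<le> \<sigma> * inradius T)"


section \<open>Lebesgue and Sobolev spaces\<close>

definition L2 :: "(real^'n) set \<Rightarrow> (real^'n \<Rightarrow> 'b::euclidean_space) set" where
  "L2 \<Omega> = {f \<in> borel_measurable (lebesgue_on \<Omega>).
              integrable (lebesgue_on \<Omega>) (\<lambda>x. (norm (f x))\<^sup>2)}"

definition l2_inner ::
    "(real^'n) set \<Rightarrow> (real^'n \<Rightarrow> 'b::euclidean_space) \<Rightarrow> (real^'n \<Rightarrow> 'b) \<Rightarrow> real" where
  "l2_inner \<Omega> f g = (LINT x|lebesgue_on \<Omega>. f x \<bullet> g x)"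

definition l2_norm :: "(real^'n) set \<Rightarrow> (real^'n \<Rightarrow> 'b::euclidean_space) \<Rightarrow> real" where
  "l2_norm \<Omega> f = sqrt (l2_inner \<Omega> f f)"

definition L20 :: "(real^'n) set \<Rightarrow> 'n sfield set" where
  "L20 \<Omega> = {q \<in> L2 \<Omega>. (LINT x|lebesgue_on \<Omega>. q x) = 0}"

text \<open>\<open>k\<close>-times continuously differentiable on the whole space, via partial derivatives.\<close>

primrec Ck :: "nat \<Rightarrow> (real^'n \<Rightarrow> 'b::euclidean_space) \<Rightarrow> bool" where
  "Ck 0 f \<longleftrightarrow> continuous_on UNIV f"
| "Ck (Suc k) f \<longleftrightarrow> (\<forall>x. f differentiable (at x)) \<and>
     (\<forall>j. Ck k (\<lambda>x. frechet_derivative f (at x) (axis j 1)))"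

definition Cc_infty :: "(real^'n) set \<Rightarrow> (real^'n \<Rightarrow> 'b::euclidean_space) set" where
  "Cc_infty \<Omega> = {\<phi>. (\<forall>k. Ck k \<phi>) \<and> compact (closure {x. \<phi> x \<noteq> 0}) \<and>
                     closure {x. \<phi> x \<noteq> 0} \<subseteq> \<Omega>}"

text \<open>The entry in row \<open>i\<close> and column \<open>j\<close> of the gradient of \<open>v\<close> is the \<open>j\<close>-th weak partial
  derivative of the \<open>i\<close>-th component.\<close>

definition is_weak_grad :: "(real^'n) set \<Rightarrow> 'n vfield \<Rightarrow> 'n mfield \<Rightarrow> bool" where
  "is_weak_grad \<Omega> v g \<longleftrightarrow> g \<in> L2 \<Omega> \<and>
     (\<forall>\<phi>::'n sfield\<in>Cc_infty \<Omega>. \<forall>i j.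
        (LINT x|lebesgue_on \<Omega>. v x $ i * frechet_derivative \<phi> (at x) (axis j 1)) =
        - (LINT x|lebesgue_on \<Omega>. g x $ i $ j * \<phi> x))"

definition H1 :: "(real^'n) set \<Rightarrow> 'n vfield set" where
  "H1 \<Omega> = {v \<in> L2 \<Omega>. \<exists>g. is_weak_grad \<Omega> v g}"

text \<open>For \<open>v \<in> H1 \<Omega>\<close> this is determined almost everywhere in \<open>\<Omega>\<close>.\<close>

definition grad :: "(real^'n) set \<Rightarrow> 'n vfield \<Rightarrow> 'n mfield" where
  "grad \<Omega> v = (SOME g. is_weak_grad \<Omega> v g)"

definition divg :: "(real^'n) set \<Rightarrow> 'n vfield \<Rightarrow> 'n sfield" where
  "divg \<Omega> v = (\<lambda>x. trace (grad \<Omega> v x))"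

definition h1_norm :: "(real^'n) set \<Rightarrow> 'n vfield \<Rightarrow> real" where
  "h1_norm \<Omega> v = sqrt ((l2_norm \<Omega> v)\<^sup>2 + (l2_norm \<Omega> (grad \<Omega> v))\<^sup>2)"

definition H10 :: "(real^'n) set \<Rightarrow> 'n vfield set" where
  "H10 \<Omega> = {v \<in> H1 \<Omega>. \<exists>\<phi>::nat \<Rightarrow> 'n vfield. (\<forall>m. \<phi> m \<in> Cc_infty \<Omega>) \<and>
               (\<lambda>m. h1_norm \<Omega> (\<lambda>x. \<phi> m x - v x)) \<longlonglongrightarrow> 0}"

definition H10_dual :: "(real^'n) set \<Rightarrow> ('n vfield \<Rightarrow> real) set" where
  "H10_dual \<Omega> = {f. (\<forall>v\<in>H10 \<Omega>. \<forall>w\<in>H10 \<Omega>. f (\<lambda>x. v x + w x) = f v + f w) \<and>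
                     (\<forall>c. \<forall>v\<in>H10 \<Omega>. f (\<lambda>x. c *\<^sub>R v x) = c * f v) \<and>
                     (\<exists>C. \<forall>v\<in>H10 \<Omega>. \<bar>f v\<bar> \<le> C * l2_norm \<Omega> (grad \<Omega> v))}"

definition dual_norm :: "(real^'n) set \<Rightarrow> ('n vfield \<Rightarrow> real) \<Rightarrow> real" where
  "dual_norm \<Omega> f = (SUP v\<in>{v \<in> H10 \<Omega>. l2_norm \<Omega> (grad \<Omega> v) \<le> 1}. \<bar>f v\<bar>)"

text \<open>\<open>grad \<Omega> v x *v u x\<close> is the value of \<open>u \<cdot> \<nabla>v\<close> at \<open>x\<close>.\<close>

definition bstar :: "(real^'n) set \<Rightarrow> 'n vfield \<Rightarrow> 'n vfield \<Rightarrow> 'n vfield \<Rightarrow> real" where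
  "bstar \<Omega> u v w = 1/2 * l2_inner \<Omega> (\<lambda>x. grad \<Omega> v x *v u x) w
                  - 1/2 * l2_inner \<Omega> (\<lambda>x. grad \<Omega> w x *v u x) v"


section \<open>Finite element spaces and the iterated penalty Picard operator\<close>

definition polynomial_deg_le :: "nat \<Rightarrow> 'n::finite sfield \<Rightarrow> bool" where
  "polynomial_deg_le k f \<longleftrightarrow>
     (\<exists>c :: ('n::finite \<Rightarrow> nat) \<Rightarrow> real. \<forall>x.
        f x = (\<Sum>\<alpha> | (\<Sum>i\<in>UNIV. \<alpha> i) \<le> k. c \<alpha> * (\<Prod>i\<in>UNIV. (x $ i) ^ \<alpha> i)))"

definition Xh :: "(real^'n) set \<Rightarrow> (real^'n) set set \<Rightarrow> nat \<Rightarrow> 'n vfield set" where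
  "Xh \<Omega> \<tau> k = {v \<in> H10 \<Omega>. continuous_on (closure \<Omega>) v \<and>
      (\<forall>T\<in>\<tau>. \<forall>i. \<exists>P. polynomial_deg_le k P \<and> (\<forall>x\<in>T. v x $ i = P x))}"

text \<open>The divergences of \<open>Xh\<close>, as elements of \<open>L20\<close>: all representatives are admitted.\<close>

definition Qh :: "(real^'n) set \<Rightarrow> (real^'n) set set \<Rightarrow> nat \<Rightarrow> 'n sfield set" where
  "Qh \<Omega> \<tau> k = {q \<in> L20 \<Omega>. \<exists>v\<in>Xh \<Omega> \<tau> k. AE x in lebesgue_on \<Omega>. q x = divg \<Omega> v x}"

definition pair_norm :: "(real^'n) set \<Rightarrow> real \<Rightarrow> real \<Rightarrow> 'n vfield \<times> 'n sfield \<Rightarrow> real" where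
  "pair_norm \<Omega> \<nu> \<epsilon> = (\<lambda>(v, q).
     sqrt (\<nu> * (l2_norm \<Omega> (grad \<Omega> v))\<^sup>2 + \<epsilon> * (l2_norm \<Omega> q)\<^sup>2))"

text \<open>The defining property of \<open>G\<close>.  It determines \<open>G\<close> up to equality almost everywhere in
  \<open>\<Omega>\<close>.\<close>

definition iterated_penalty_picard ::
    "(real^'n) set \<Rightarrow> (real^'n) set set \<Rightarrow> nat \<Rightarrow> real \<Rightarrow> real \<Rightarrow> ('n vfield \<Rightarrow> real) \<Rightarrow>
     ('n vfield \<times> 'n sfield \<Rightarrow> 'n vfield \<times> 'n sfield) \<Rightarrow> bool" where
  "iterated_penalty_picard \<Omega> \<tau> k \<nu> \<epsilon> f G \<longleftrightarrow>
     (\<forall>u\<in>Xh \<Omega> \<tau> k. \<forall>p\<in>Qh \<Omega> \<tau> k.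
        G (u, p) \<in> Xh \<Omega> \<tau> k \<times> Qh \<Omega> \<tau> k \<and>
        (\<forall>v\<in>Xh \<Omega> \<tau> k. \<forall>q\<in>Qh \<Omega> \<tau> k.
           \<nu> * l2_inner \<Omega> (grad \<Omega> (fst (G (u, p)))) (grad \<Omega> v)
             + bstar \<Omega> u (fst (G (u, p))) v
             - l2_inner \<Omega> (snd (G (u, p))) (divg \<Omega> v) = f v \<and>
           \<epsilon> * l2_inner \<Omega> (snd (G (u, p))) q + l2_inner \<Omega> (divg \<Omega> (fst (G (u, p)))) q
             = \<epsilon> * l2_inner \<Omega> p q))"

end

theory Submission
  imports Defs
begin

text \<open>
  Write \<open>(g, s) = G (u, p)\<close>, \<open>(h, t) = G (w, z)\<close>.  Subtracting the two systems and testing with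
  \<open>(g - h, s - t)\<close> gives, by skew symmetry of \<open>b\<^sup>*\<close>,
  \<open>\<nu> |\<nabla>(g - h)|\<^sup>2 + \<epsilon> |s - t|\<^sup>2 = b\<^sup>*(w - u, g, g - h) + \<epsilon> (p - z, s - t)\<close>, and testing the system for
  \<open>(g, s)\<close> with its own solution bounds \<open>|\<nabla>g|\<close> by \<open>|f| / \<nu> + sqrt (\<epsilon> / \<nu>) |p|\<close>.  The claim follows by
  Cauchy-Schwarz.

  Since \<open>grad\<close> is a choice of a weak gradient, its linearity (almost everywhere) needs uniqueness of
  weak gradients, that is, the fundamental lemma of the calculus of variations.  Trilinearity of
  \<open>bstar\<close> needs integrability of its integrands, which holds on \<open>Xh\<close> because finite element
  functions are bounded.
\<close>

subsection \<open>Test functions\<close>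

text \<open>The difference of the convection terms splits as \<open>bstar\<close> of (u - w, g, v)
  plus \<open>bstar\<close> of (w, g - h, v). Keeping \<open>g\<close> in the first part is why the
  constant involves the norm of \<open>p\<close> but not of \<open>z\<close>. On testing with the
  difference of the solutions, the second part and the pressure-divergence terms drop out, so the
  pressure is controlled by the penalty term alone. What survives carries the factor M |grad g| / nu
  on the velocity side, which the stability bound turns into kappa + sqrt(eps / nu^3) M |p|, and the
  factor 1 on the pressure side; hence the maximum.

  Most of the work is forced by representatives. As \<open>grad\<close> picks some weak gradient,
  and is unspecified for a function that has none, even closure of \<open>H10\<close> under
  differences requires the approximating smooth fields to have weak gradients, hence integration by
  parts. The fundamental lemma in turn requires an explicit supply of smooth compactly supported
  functions.\<close>

definition flat_exp :: "nat \<Rightarrow> real \<Rightarrow> real" where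
  "flat_exp j t = (if 0 < t then (1 / t) ^ j * exp (- (1 / t)) else 0)"

lemma flat_exp_at_right: "(flat_exp j \<longlongrightarrow> 0) (at_right 0)"
proof -
  have "((\<lambda>t::real. inverse t ^ j / exp (inverse t)) \<longlongrightarrow> 0) (at_right 0)"
    using filterlim_compose[OF tendsto_power_div_exp_0 filterlim_inverse_at_top_right] .
  moreover have "\<forall>\<^sub>F t in at_right 0. inverse t ^ j / exp (inverse t) = flat_exp j t"
    using eventually_at_right_less[of "0::real"]
    by eventually_elim (auto simp: flat_exp_def exp_minus field_simps)
  ultimately show ?thesis
    by (rule Lim_transform_eventually)
qed

lemma flat_exp_at_zero: "(flat_exp j \<longlongrightarrow> 0) (at 0)"
proof -
  have "(flat_exp j \<longlongrightarrow> 0) (at_left 0)"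
    by (rule Lim_transform_eventually[OF tendsto_const])
      (use eventually_at_left_real[of "-1" "0::real"] in \<open>auto elim!: eventually_mono simp: flat_exp_def\<close>)
  then show ?thesis
    using flat_exp_at_right by (simp add: filterlim_split_at)
qed

text \<open>The index \<open>j\<close> exists for this formula: differentiating t^(-j) e^(-1/t)
  yields the same shape with exponents j + 2 and j + 1, so no new functions arise. At 0 the
  difference quotient is \<open>flat_exp (Suc j)\<close> itself, which tends to 0.\<close>

lemma flat_exp_has_derivative:
  "(flat_exp j has_real_derivative (flat_exp (j + 2) t - j * flat_exp (j + 1) t)) (at t)"
proof (cases t "0::real" rule: linorder_cases)
  case less
  have "((\<lambda>_. 0) has_real_derivative 0) (at t)" by simp
  then have "(flat_exp j has_real_derivative 0) (at t)"
    by (rule has_field_derivative_transform_within_open[of _ _ _ "{..<0}"])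
      (use less in \<open>auto simp: flat_exp_def\<close>)
  then show ?thesis using less by (simp add: flat_exp_def)
next
  case equal
  have "((\<lambda>h. (flat_exp j h - flat_exp j 0) / h) \<longlongrightarrow> 0) (at 0)"
  proof (rule Lim_transform_eventually[OF flat_exp_at_zero[of "Suc j"]])
    show "\<forall>\<^sub>F h in at 0. flat_exp (Suc j) h = (flat_exp j h - flat_exp j 0) / h"
      by (auto simp: flat_exp_def)
  qed
  then have "(flat_exp j has_real_derivative 0) (at 0)"
    by (simp add: DERIV_def)
  then show ?thesis using equal by (simp add: flat_exp_def)
next
  case greater
  have "((\<lambda>t. (1 / t) ^ j * exp (- (1 / t))) has_real_derivative
      (flat_exp (j + 2) t - j * flat_exp (j + 1) t)) (at t)"
    using greater
    by (auto intro!: derivative_eq_intros simp: flat_exp_def divide_simps power_Suc[symmetric]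
        simp del: power_Suc) (cases j; simp add: field_simps)
  then show ?thesis
    by (rule has_field_derivative_transform_within_open[of _ _ _ "{0<..}"])
      (use greater in \<open>auto simp: flat_exp_def\<close>)
qed

text \<open>An algebra of functions closed under partial derivatives; hence all its members are smooth.\<close>

inductive_set flat_alg :: "(real^'n \<Rightarrow> real) set" where
  const: "(\<lambda>_. c) \<in> flat_alg"
| add: "f \<in> flat_alg \<Longrightarrow> g \<in> flat_alg \<Longrightarrow> (\<lambda>x. f x + g x) \<in> flat_alg"
| mult: "f \<in> flat_alg \<Longrightarrow> g \<in> flat_alg \<Longrightarrow> (\<lambda>x. f x * g x) \<in> flat_alg"
| flat: "(\<lambda>x. flat_exp j (c * (x $ i) + d)) \<in> flat_alg"

lemma flat_alg_prod:
  "finite I \<Longrightarrow> (\<And>i. i \<in> I \<Longrightarrow> F i \<in> flat_alg) \<Longrightarrow> (\<lambda>x. \<Prod>i\<in>I. F i x) \<in> flat_alg"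
  by (induction I rule: finite_induct) (auto intro: flat_alg.intros)

text \<open>Membership is claimed for the derivative in every fixed direction, so that the statement
  can be iterated to partial derivatives of any order.\<close>

lemma flat_alg_derivative:
  fixes f :: "real^'n \<Rightarrow> real"
  assumes "f \<in> flat_alg"
  shows "\<exists>D. (\<forall>x. (f has_derivative D x) (at x)) \<and> (\<forall>v. (\<lambda>x. D x v) \<in> flat_alg)"
  using assms
proof induction
  case (const c)
  show ?case
    by (rule exI[of _ "\<lambda>_ _. 0"]) (auto intro: flat_alg.const)
next
  case (add f g)
  then obtain D E where "\<forall>x. (f has_derivative D x) (at x)" "\<forall>v. (\<lambda>x. D x v) \<in> flat_alg"
     "\<forall>x. (g has_derivative E x) (at x)" "\<forall>v. (\<lambda>x. E x v) \<in> flat_alg" by blast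
  then show ?case
    by (intro exI[of _ "\<lambda>x v. D x v + E x v"]) (auto intro: flat_alg.add has_derivative_add)
next
  case (mult f g)
  then obtain D E where "\<forall>x. (f has_derivative D x) (at x)" "\<forall>v. (\<lambda>x. D x v) \<in> flat_alg"
     "\<forall>x. (g has_derivative E x) (at x)" "\<forall>v. (\<lambda>x. E x v) \<in> flat_alg" by blast
  with mult show ?case
    by (intro exI[of _ "\<lambda>x v. f x * E x v + D x v * g x"])
      (intro conjI allI has_derivative_mult flat_alg.add flat_alg.mult; simp)
next
  case (flat j c i d)
  let ?t = "\<lambda>x::real^'n. c * (x $ i) + d"
  \<comment> \<open>The subtraction is spelled as adding a multiple by \<open>- real j\<close>,
    because the algebra is generated by constants, sums and products.\<close>
  let ?D = "\<lambda>x v::real^'n. (flat_exp (j + 2) (?t x) + (- real j) * flat_exp (j + 1) (?t x)) * (c * v $ i)"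
  have "((\<lambda>x. flat_exp j (?t x)) has_derivative ?D x) (at x)" for x
  proof -
    have "(?t has_derivative (\<lambda>v. c * v $ i)) (at x)"
      by (auto intro!: derivative_eq_intros bounded_linear_imp_has_derivative bounded_linear_vec_nth)
    from has_derivative_compose[OF this flat_exp_has_derivative[unfolded has_field_derivative_def]]
    show ?thesis by simp
  qed
  then show ?case
    by (intro exI[of _ ?D]) (intro conjI allI flat_alg.intros; assumption?)
qed

lemma flat_alg_Ck: "f \<in> flat_alg \<Longrightarrow> Ck k f"
proof (induction k arbitrary: f)
  case 0
  with flat_alg_derivative[OF this] show ?case
    by (auto intro: continuous_at_imp_continuous_on dest: has_derivative_continuous)
next
  case (Suc k)
  obtain D where D: "\<And>x. (f has_derivative D x) (at x)" "\<And>v. (\<lambda>x. D x v) \<in> flat_alg"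
    using flat_alg_derivative[OF Suc.prems] by blast
  have "frechet_derivative f (at x) = D x" for x
    using frechet_derivative_at[OF D(1)] by simp
  then show ?case
    using D Suc.IH by (auto simp: differentiable_def)
qed

text \<open>Smooth approximants from below of the indicator of the open box: each coordinate
  contributes a factor e^(-1/s), cut off at s = 0, for either face, and \<open>m\<close> steepens
  the faces.\<close>

definition box_bump :: "real^'n \<Rightarrow> real^'n \<Rightarrow> nat \<Rightarrow> real^'n \<Rightarrow> real" where
  "box_bump a b m x = (\<Prod>i\<in>UNIV. flat_exp 0 (m * (x $ i - a $ i)) * flat_exp 0 (m * (b $ i - x $ i)))"

lemma flat_exp_0_bounds: "0 \<le> flat_exp 0 t" "flat_exp 0 t \<le> 1"
  by (auto simp: flat_exp_def)

lemma box_bump_bounds: "0 \<le> box_bump a b m x" "box_bump a b m x \<le> 1"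
  unfolding box_bump_def
  by (auto intro!: prod_nonneg prod_le_1 mult_nonneg_nonneg mult_le_one flat_exp_0_bounds)

lemma box_bump_outside: "x \<notin> box a b \<Longrightarrow> box_bump a b m x = 0"
  by (auto simp: box_bump_def mem_box_cart flat_exp_def zero_less_mult_iff not_less
      intro!: prod_zero) (metis linorder_not_less)+

lemma box_bump_tendsto:
  fixes x :: "real^'n"
  shows "(\<lambda>m. box_bump a b m x) \<longlonglongrightarrow> indicator (box a b) x"
proof (cases "x \<in> box a b")
  case True
  have *: "(\<lambda>m. flat_exp 0 (real m * t)) \<longlonglongrightarrow> 1" if "0 < t" for t
  proof -
    have "(\<lambda>m. exp (- (1 / t * inverse (real m)))) \<longlonglongrightarrow> exp (- (1 / t * 0))"
      by (intro tendsto_intros lim_inverse_n)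
    moreover have "\<forall>\<^sub>F m in sequentially. exp (- (1 / t * inverse (real m))) = flat_exp 0 (real m * t)"
      using eventually_gt_at_top[of 0]
      by eventually_elim (use that in \<open>auto simp: flat_exp_def field_simps\<close>)
    ultimately show ?thesis by (auto intro: Lim_transform_eventually)
  qed
  have "(\<lambda>m. box_bump a b m x) \<longlonglongrightarrow> (\<Prod>i\<in>(UNIV::'n set). 1 * (1::real))"
    unfolding box_bump_def
    by (intro tendsto_prod tendsto_mult *) (use True in \<open>auto simp: mem_box_cart\<close>)
  then show ?thesis using True by simp
next
  case False
  then show ?thesis by (simp add: box_bump_outside)
qed

lemma box_bump_Cc_infty:
  assumes "cbox a b \<subseteq> \<Omega>"
  shows "box_bump a b m \<in> Cc_infty \<Omega>"
proof -
  \<comment> \<open>The scaled distances to the faces are brought into the affine form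
    \<open>c * (x $ i) + d\<close>, the only arguments of \<open>flat_exp\<close> that
    \<open>flat_alg\<close> admits.\<close>
  have "(\<lambda>x. flat_exp 0 (m * x $ i + - (m * a $ i)) * flat_exp 0 (- real m * x $ i + m * b $ i))
      \<in> flat_alg" for i
    by (intro flat_alg.intros)
  then have "(\<lambda>x. flat_exp 0 (m * (x $ i - a $ i)) * flat_exp 0 (m * (b $ i - x $ i))) \<in> flat_alg" for i
    by (simp add: algebra_simps)
  then have "box_bump a b m \<in> flat_alg"
    unfolding box_bump_def by (intro flat_alg_prod) auto
  moreover have "closure {x. box_bump a b m x \<noteq> 0} \<subseteq> cbox a b"
    by (rule closure_minimal) (use box_bump_outside box_subset_cbox in blast)+
  ultimately show ?thesis
    using assms flat_alg_Ck unfolding Cc_infty_def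
    by (auto simp: compact_eq_bounded_closed intro: bounded_subset[OF bounded_cbox])
qed

lemma Ck_imp_continuous: "Ck k f \<Longrightarrow> continuous_on UNIV f"
  by (cases k) (auto intro: differentiable_imp_continuous_on simp: differentiable_on_def)

text \<open>Testing with bumps shows that \<open>g\<close> integrates to zero over every closed box
  inside the domain; Lebesgue differentiation along shrinking cubes then makes \<open>g\<close>
  vanish almost everywhere.\<close>

lemma fundamental_lemma_calculus_of_variations:
  fixes g :: "real^'n \<Rightarrow> real"
  assumes \<Omega>: "open \<Omega>" and g: "integrable (lebesgue_on \<Omega>) g"
    and orth: "\<And>\<phi>. \<phi> \<in> Cc_infty \<Omega> \<Longrightarrow> (LINT x|lebesgue_on \<Omega>. g x * \<phi> x) = 0"
  shows "AE x in lebesgue_on \<Omega>. g x = 0"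
proof -
  have \<Omega>_sets: "\<Omega> \<in> sets lebesgue" using \<Omega> by auto
  \<comment> \<open>Extension by zero turns integrals over boxes into integrals of one function on
    the whole space, to which the differentiation theorem applies.\<close>
  define F where "F x = (if x \<in> \<Omega> then g x else 0)" for x
  have F: "integrable lebesgue F"
    unfolding F_def using g \<Omega>_sets by (simp add: Lebesgue_Measure.integrable_restrict_UNIV)
  have box0: "integral (cbox a b) F = 0" if ab: "cbox a b \<subseteq> \<Omega>" for a b
  proof -
    have meas: "box_bump a b m \<in> borel_measurable (lebesgue_on \<Omega>)" for m
      using box_bump_Cc_infty[OF ab, of m]
      by (intro continuous_imp_measurable_on_sets_lebesgue \<Omega>_sets)
        (auto simp: Cc_infty_def intro: continuous_on_subset[OF Ck_imp_continuous])
    have bm: "indicat_real (box a b) \<in> borel_measurable (lebesgue_on \<Omega>)"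
      by (intro measurable_restrict_space1 borel_measurable_indicator) auto
    have "(\<lambda>m. LINT x|lebesgue_on \<Omega>. g x * box_bump a b m x)
        \<longlonglongrightarrow> (LINT x|lebesgue_on \<Omega>. g x * indicator (box a b) x)"
    proof (rule integral_dominated_convergence[where w = "\<lambda>x. norm (g x)"])
      show "AE x in lebesgue_on \<Omega>. (\<lambda>m. g x * box_bump a b m x) \<longlonglongrightarrow> g x * indicator (box a b) x"
        by (intro AE_I2 tendsto_intros box_bump_tendsto)
      show "AE x in lebesgue_on \<Omega>. norm (g x * box_bump a b m x) \<le> norm (g x)" for m
        using box_bump_bounds[of a b m]
        by (intro AE_I2) (auto simp: abs_mult intro!: mult_left_le)
    qed (use g meas bm in \<open>auto intro!: borel_measurable_times\<close>)
    moreover have "(LINT x|lebesgue_on \<Omega>. g x * box_bump a b m x) = 0" for m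
      using orth box_bump_Cc_infty[OF ab] by auto
    ultimately have z: "(LINT x|lebesgue_on \<Omega>. g x * indicator (box a b) x) = 0"
      by (simp add: LIMSEQ_const_iff)
    have "integral (cbox a b) F = integral (box a b) F"
      by (rule integral_open_interval[symmetric])
    also have "\<dots> = (LINT x|lebesgue_on (box a b). F x)"
      by (rule lebesgue_integral_eq_integral[symmetric])
        (use integrable_mult_indicator[of "box a b" lebesgue F] F in \<open>auto simp: integrable_restrict_space\<close>)
    also have "\<dots> = (LINT x|lebesgue. indicator \<Omega> x *\<^sub>R (g x * indicator (box a b) x))"
      by (subst integral_restrict_space) (auto simp: F_def indicator_def intro!: Bochner_Integration.integral_cong)
    also have "\<dots> = (LINT x|lebesgue_on \<Omega>. g x * indicator (box a b) x)"
      by (subst integral_restrict_space) (use \<Omega>_sets in auto)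
    finally show ?thesis using z by simp
  qed
  have "F integrable_on cbox a b" for a b
  proof -
    have "integrable (lebesgue_on (cbox a b)) F"
      using integrable_mult_indicator[of "cbox a b" lebesgue F] F by (auto simp: integrable_restrict_space)
    then show ?thesis by (intro integrable_on_lebesgue_on) auto
  qed
  then obtain N where N: "negligible N"
    and lim: "\<And>x e. x \<notin> N \<Longrightarrow> 0 < e \<Longrightarrow> \<exists>d>0. \<forall>h. 0 < h \<and> h < d \<longrightarrow>
        norm (integral (cbox x (x + h *\<^sub>R One)) F /\<^sub>R h ^ DIM(real^'n) - F x) < e"
    using integrable_ccontinuous_explicit by blast
  have zero: "F x = 0" if x: "x \<notin> N" "x \<in> \<Omega>" for x
  proof (rule ccontr)
    assume "F x \<noteq> 0"
    with lim[OF x(1), of "norm (F x)"] obtain d where d: "d > 0" and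
      l: "\<And>h. 0 < h \<Longrightarrow> h < d \<Longrightarrow> 
        norm (integral (cbox x (x + h *\<^sub>R One)) F /\<^sub>R h ^ DIM(real^'n) - F x) < norm (F x)" by auto
    obtain r where r: "r > 0" "ball x r \<subseteq> \<Omega>" using \<Omega> x(2) open_contains_ball by blast
    \<comment> \<open>The cube has corner \<open>x\<close> and side \<open>h\<close>, so its points
      lie within \<open>h * norm One\<close> of \<open>x\<close>, which is at most
      \<open>r / 2\<close>; the added 1 keeps the denominator visibly positive.\<close>
    define h where "h = min (d / 2) (r / (2 * (norm (One::real^'n) + 1)))"
    have h: "0 < h" "h < d" using d r by (auto simp: h_def add_nonneg_pos)
    have "cbox x (x + h *\<^sub>R One) \<subseteq> ball x r"
    proof
      fix y assume y: "y \<in> cbox x (x + h *\<^sub>R One)"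
      have "norm (y - x) \<le> norm (h *\<^sub>R One :: real^'n)"
        by (rule norm_le_componentwise) (use y h in \<open>auto simp: mem_box inner_simps\<close>)
      also have "\<dots> = h * norm (One::real^'n)" using h by simp
      also have "\<dots> \<le> h * (norm (One::real^'n) + 1)" using h by simp
      also have "\<dots> \<le> r / (2 * (norm (One::real^'n) + 1)) * (norm (One::real^'n) + 1)"
        by (intro mult_right_mono) (auto simp: h_def)
      also have "\<dots> = r / 2" 
        by (simp add: divide_simps) (smt (verit) norm_ge_zero)
      also have "\<dots> < r" using r by simp
      finally show "y \<in> ball x r" by (simp add: dist_norm norm_minus_commute)
    qed
    then have "integral (cbox x (x + h *\<^sub>R One)) F = 0" using box0 r by blast
    with l[OF h] show False by simp
  qed
  have "N \<in> null_sets lebesgue" using N negligible_iff_null_sets by blast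
  then have "AE x in lebesgue. x \<notin> N" by (rule AE_not_in)
  then have "AE x in lebesgue. x \<in> \<Omega> \<longrightarrow> g x = 0"
    by eventually_elim (use zero in \<open>auto simp: F_def\<close>)
  then show ?thesis
    using \<Omega>_sets by (subst AE_restrict_space_iff) auto
qed

subsection \<open>Square integrable functions\<close>

lemma L2_I_bound:
  assumes "f \<in> borel_measurable (lebesgue_on \<Omega>)" and "integrable (lebesgue_on \<Omega>) h"
    and "\<And>x. (norm (f x))\<^sup>2 \<le> h x"
  shows "f \<in> L2 \<Omega>"
  unfolding L2_def using assms
  by (auto intro!: Bochner_Integration.integrable_bound[OF assms(2)] AE_I2 order_trans[OF assms(3) abs_ge_self])

lemma L2_measurable: "f \<in> L2 \<Omega> \<Longrightarrow> f \<in> borel_measurable (lebesgue_on \<Omega>)"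
  by (simp add: L2_def)

lemma L2_square_integrable: "f \<in> L2 \<Omega> \<Longrightarrow> integrable (lebesgue_on \<Omega>) (\<lambda>x. (norm (f x))\<^sup>2)"
  by (simp add: L2_def)

lemma norm_diff_square_le: "(norm (a - b))\<^sup>2 \<le> 2 * (norm a)\<^sup>2 + 2 * (norm b)\<^sup>2"
  for a b :: "'a::real_inner"
proof -
  have "0 \<le> (norm (a + b))\<^sup>2" by simp
  then show ?thesis
    by (simp add: power2_norm_eq_inner inner_simps inner_commute)
qed

lemma L2_diff:
  assumes "f \<in> L2 \<Omega>" "g \<in> L2 \<Omega>"
  shows "(\<lambda>x. f x - g x) \<in> L2 \<Omega>"
proof (rule L2_I_bound)
  show "integrable (lebesgue_on \<Omega>) (\<lambda>x. 2 * (norm (f x))\<^sup>2 + 2 * (norm (g x))\<^sup>2)"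
    using assms by (auto simp: L2_def)
  show "(\<lambda>x. f x - g x) \<in> borel_measurable (lebesgue_on \<Omega>)"
    using assms by (auto simp: L2_def intro: borel_measurable_diff)
qed (rule norm_diff_square_le)

lemma L2_bounded_linear:
  assumes "f \<in> L2 \<Omega>" "bounded_linear T"
  shows "(\<lambda>x. T (f x)) \<in> L2 \<Omega>"
proof -
  obtain K where K: "\<And>x. norm (T x) \<le> norm x * K"
    using bounded_linear.bounded[OF assms(2)] by blast
  show ?thesis
  proof (rule L2_I_bound)
    show "integrable (lebesgue_on \<Omega>) (\<lambda>x. (norm (f x))\<^sup>2 * K\<^sup>2)"
      using assms by (auto simp: L2_def)
    show "(\<lambda>x. T (f x)) \<in> borel_measurable (lebesgue_on \<Omega>)"
      by (rule borel_measurable_continuous_on[OF linear_continuous_on L2_measurable]) (use assms in auto)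
    show "(norm (T (f x)))\<^sup>2 \<le> (norm (f x))\<^sup>2 * K\<^sup>2" for x
      using power_mono[OF K[of "f x"], of 2] by (simp add: power_mult_distrib)
  qed
qed

lemma L2_scaleR: "f \<in> L2 \<Omega> \<Longrightarrow> (\<lambda>x. c *\<^sub>R f x) \<in> L2 \<Omega>"
  by (rule L2_bounded_linear) (auto intro: bounded_linear_scaleR_right)

text \<open>Serves the integrand of \<open>bstar\<close>, a gradient applied to a velocity. The
  bound on \<open>u\<close> is asked only inside the domain, since representatives are arbitrary
  outside.\<close>

lemma L2_bounded_bilinear:
  fixes u :: "real^'n \<Rightarrow> 'b::euclidean_space"
  assumes "f \<in> L2 \<Omega>" "u \<in> borel_measurable (lebesgue_on \<Omega>)" "\<And>x. x \<in> \<Omega> \<Longrightarrow> norm (u x) \<le> C"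
    and B: "bounded_bilinear B" and "\<Omega> \<in> sets lebesgue"
  shows "(\<lambda>x. B (f x) (u x)) \<in> L2 \<Omega>"
proof -
  obtain K where K: "0 < K" "\<And>a b. norm (B a b) \<le> norm a * norm b * K"
    using bounded_bilinear.pos_bounded[OF B] by blast
  have meas: "(\<lambda>x. B (f x) (u x)) \<in> borel_measurable (lebesgue_on \<Omega>)"
    by (rule borel_measurable_continuous_Pair[OF L2_measurable[OF assms(1)] assms(2)])
      (intro bounded_bilinear.continuous_on[OF B] continuous_intros)
  have "integrable (lebesgue_on \<Omega>) (\<lambda>x. (norm (f x))\<^sup>2 * (C * K)\<^sup>2)"
    using assms by (auto simp: L2_def)
  then have "integrable (lebesgue_on \<Omega>) (\<lambda>x. (norm (B (f x) (u x)))\<^sup>2)"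
  proof (rule Bochner_Integration.integrable_bound)
    show "AE x in lebesgue_on \<Omega>. norm ((norm (B (f x) (u x)))\<^sup>2) \<le> norm ((norm (f x))\<^sup>2 * (C * K)\<^sup>2)"
    proof (rule AE_I2)
      fix x assume "x \<in> space (lebesgue_on \<Omega>)"
      then have "norm (u x) \<le> C" using assms by auto
      then have "norm (f x) * norm (u x) * K \<le> norm (f x) * C * K"
        using K by (intro mult_right_mono mult_left_mono) auto
      then have "norm (B (f x) (u x)) \<le> norm (f x) * (C * K)"
        using K(2)[of "f x" "u x"] by (simp add: mult.assoc)
      from power_mono[OF this, of 2] 
      show "norm ((norm (B (f x) (u x)))\<^sup>2) \<le> norm ((norm (f x))\<^sup>2 * (C * K)\<^sup>2)"
        by (simp add: power_mult_distrib)
    qed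
  qed (use meas in measurable)
  with meas show ?thesis by (simp add: L2_def)
qed

lemma L2_inner_integrable:
  assumes "f \<in> L2 \<Omega>" "g \<in> L2 \<Omega>"
  shows "integrable (lebesgue_on \<Omega>) (\<lambda>x. f x \<bullet> g x)"
proof (rule Bochner_Integration.integrable_bound)
  show "integrable (lebesgue_on \<Omega>) (\<lambda>x. (norm (f x))\<^sup>2 + (norm (g x))\<^sup>2)"
    using assms by (auto simp: L2_def)
  show "(\<lambda>x. f x \<bullet> g x) \<in> borel_measurable (lebesgue_on \<Omega>)"
    using assms by (auto simp: L2_def intro: borel_measurable_inner)
  have "\<bar>a \<bullet> b\<bar> \<le> (norm a)\<^sup>2 + (norm b)\<^sup>2" for a b :: 'b
  proof -
    have "\<bar>a \<bullet> b\<bar> \<le> norm a * norm b" by (rule Cauchy_Schwarz_ineq2)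
    also have "2 * (norm a * norm b) \<le> (norm a)\<^sup>2 + (norm b)\<^sup>2"
      using sum_squares_bound[of "norm a" "norm b"] by (simp add: mult.assoc)
    finally show ?thesis by (smt (verit) mult_nonneg_nonneg norm_ge_zero)
  qed
  then show "AE x in lebesgue_on \<Omega>. norm (f x \<bullet> g x) \<le> norm ((norm (f x))\<^sup>2 + (norm (g x))\<^sup>2)"
    by auto
qed

section \<open>The L2 pairing and seminorm on representatives\<close>

lemma l2_inner_commute: "l2_inner \<Omega> f g = l2_inner \<Omega> g f"
  by (simp add: l2_inner_def inner_commute)

lemma l2_inner_diff_left:
  "f \<in> L2 \<Omega> \<Longrightarrow> g \<in> L2 \<Omega> \<Longrightarrow> h \<in> L2 \<Omega> \<Longrightarrow>
    l2_inner \<Omega> (\<lambda>x. f x - g x) h = l2_inner \<Omega> f h - l2_inner \<Omega> g h"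
  unfolding l2_inner_def inner_diff_left
  by (intro Bochner_Integration.integral_diff L2_inner_integrable)

lemma l2_inner_diff_right:
  "f \<in> L2 \<Omega> \<Longrightarrow> g \<in> L2 \<Omega> \<Longrightarrow> h \<in> L2 \<Omega> \<Longrightarrow>
    l2_inner \<Omega> h (\<lambda>x. f x - g x) = l2_inner \<Omega> h f - l2_inner \<Omega> h g"
  by (simp add: l2_inner_commute[of \<Omega> h] l2_inner_diff_left)

lemma l2_inner_scaleR_left: "l2_inner \<Omega> (\<lambda>x. c *\<^sub>R f x) g = c * l2_inner \<Omega> f g"
  by (simp add: l2_inner_def)

lemma l2_inner_cong_AE:
  assumes "f \<in> L2 \<Omega>" "f' \<in> L2 \<Omega>" "g \<in> L2 \<Omega>" "g' \<in> L2 \<Omega>"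
    and "AE x in lebesgue_on \<Omega>. f x = f' x" "AE x in lebesgue_on \<Omega>. g x = g' x"
  shows "l2_inner \<Omega> f g = l2_inner \<Omega> f' g'"
  unfolding l2_inner_def
proof (rule integral_cong_AE)
  show "AE x in lebesgue_on \<Omega>. f x \<bullet> g x = f' x \<bullet> g' x"
    using assms(5,6) by eventually_elim simp
qed (use assms L2_inner_integrable borel_measurable_integrable in blast)+

lemma l2_inner_self_nonneg: "0 \<le> l2_inner \<Omega> f f"
  by (simp add: l2_inner_def)

lemma l2_norm_nonneg: "0 \<le> l2_norm \<Omega> f"
  by (simp add: l2_norm_def l2_inner_self_nonneg)

lemma l2_norm_square: "(l2_norm \<Omega> f)\<^sup>2 = l2_inner \<Omega> f f"
  by (simp add: l2_norm_def l2_inner_self_nonneg)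

lemma l2_norm_cong_AE:
  assumes "f \<in> L2 \<Omega>" "g \<in> L2 \<Omega>" "AE x in lebesgue_on \<Omega>. f x = g x"
  shows "l2_norm \<Omega> f = l2_norm \<Omega> g"
  unfolding l2_norm_def using l2_inner_cong_AE[OF assms(1,2) assms(1,2,3,3)] by simp

lemma l2_norm_scaleR: "l2_norm \<Omega> (\<lambda>x. c *\<^sub>R f x) = \<bar>c\<bar> * l2_norm \<Omega> f"
proof -
  have "l2_inner \<Omega> (\<lambda>x. c *\<^sub>R f x) (\<lambda>x. c *\<^sub>R f x) = c\<^sup>2 * l2_inner \<Omega> f f"
    by (simp add: l2_inner_def power2_eq_square mult.assoc)
  then show ?thesis
    by (simp add: l2_norm_def real_sqrt_mult)
qed

lemma l2_norm_diff_square: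
  assumes "f \<in> L2 \<Omega>" "g \<in> L2 \<Omega>"
  shows "(l2_norm \<Omega> (\<lambda>x. f x - g x))\<^sup>2 = (l2_norm \<Omega> f)\<^sup>2 - 2 * l2_inner \<Omega> f g + (l2_norm \<Omega> g)\<^sup>2"
  using assms
  by (simp add: l2_norm_square l2_inner_diff_left l2_inner_diff_right L2_diff l2_inner_commute[of \<Omega> g f])

text \<open>On representatives \<open>l2_norm\<close> is only a seminorm, so the argument rests on
  nonnegativity of a quadratic form in \<open>s\<close> and \<open>t\<close> and treats a second
  factor of norm zero separately.\<close>

lemma l2_inner_Cauchy_Schwarz:
  assumes f: "f \<in> L2 \<Omega>" and g: "g \<in> L2 \<Omega>"
  shows "\<bar>l2_inner \<Omega> f g\<bar> \<le> l2_norm \<Omega> f * l2_norm \<Omega> g"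
proof -
  let ?a = "l2_norm \<Omega> f" and ?b = "l2_norm \<Omega> g" and ?i = "l2_inner \<Omega> f g"
  have q: "0 \<le> s\<^sup>2 * ?a\<^sup>2 - 2 * (s * t) * ?i + t\<^sup>2 * ?b\<^sup>2" for s t
  proof -
    have "0 \<le> (l2_norm \<Omega> (\<lambda>x. s *\<^sub>R f x - t *\<^sub>R g x))\<^sup>2" by simp
    also have "\<dots> = s\<^sup>2 * ?a\<^sup>2 - 2 * (s * t) * ?i + t\<^sup>2 * ?b\<^sup>2"
      by (subst l2_norm_diff_square)
        (simp_all add: f g L2_scaleR l2_norm_scaleR l2_inner_scaleR_left
          l2_inner_commute[of \<Omega> f "\<lambda>x. t *\<^sub>R g x"] l2_inner_commute[of \<Omega> g f] power_mult_distrib)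
    finally show ?thesis .
  qed
  have "?i\<^sup>2 \<le> ?a\<^sup>2 * ?b\<^sup>2"
  proof (cases "?b = 0")
    case True
    have "?i = 0"
    proof (rule ccontr)
      assume i: "?i \<noteq> 0"
      \<comment> \<open>With a nonzero pairing, this choice of \<open>t\<close> would give the form
        the value -1.\<close>
      have "0 \<le> ?a\<^sup>2 - 2 * ((?a\<^sup>2 + 1) / (2 * ?i)) * ?i"
        using q[of 1 "(?a\<^sup>2 + 1) / (2 * ?i)"] True by simp
      with i show False by simp
    qed
    then show ?thesis by simp
  next
    case False
    then have b: "?b\<^sup>2 > 0" by simp
    \<comment> \<open>Taking the squared norm of \<open>g\<close> for \<open>s\<close> and the
      pairing for \<open>t\<close> turns the form into a positive multiple of the quantity whose
      sign is wanted.\<close>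
    have "0 \<le> ?b\<^sup>2 * (?a\<^sup>2 * ?b\<^sup>2 - ?i\<^sup>2)"
      using q[of "?b\<^sup>2" ?i] by (simp add: power2_eq_square algebra_simps)
    with b show ?thesis by (simp add: zero_le_mult_iff)
  qed
  then have "\<bar>?i\<bar> \<le> \<bar>?a * ?b\<bar>"
    by (simp add: abs_le_square_iff power_mult_distrib)
  then show ?thesis by (simp add: l2_norm_nonneg)
qed

lemma l2_norm_diff_commute: "l2_norm \<Omega> (\<lambda>x. f x - g x) = l2_norm \<Omega> (\<lambda>x. g x - f x)"
  using l2_norm_scaleR[of \<Omega> "-1" "\<lambda>x. f x - g x"] by simp

lemma l2_norm_diff_square_le:
  assumes "f \<in> L2 \<Omega>" "g \<in> L2 \<Omega>"
  shows "(l2_norm \<Omega> (\<lambda>x. f x - g x))\<^sup>2 \<le> 2 * (l2_norm \<Omega> f)\<^sup>2 + 2 * (l2_norm \<Omega> g)\<^sup>2"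
proof -
  have "\<bar>2 * l2_inner \<Omega> f g\<bar> \<le> 2 * l2_norm \<Omega> f * l2_norm \<Omega> g"
    using l2_inner_Cauchy_Schwarz[OF assms] by simp
  then show ?thesis
    using sum_squares_bound[of "l2_norm \<Omega> f" "l2_norm \<Omega> g"] l2_norm_diff_square[OF assms] by linarith
qed


subsection \<open>Integration by parts\<close>

lemma has_derivative_line:
  assumes "(F has_derivative F') (at (x + t *\<^sub>R e))"
  shows "((\<lambda>s. F (x + s *\<^sub>R e)) has_real_derivative F' e) (at t)"
proof -
  have "((\<lambda>s. x + s *\<^sub>R e) has_derivative (\<lambda>s. s *\<^sub>R e)) (at t)"
    by (auto intro!: derivative_eq_intros)
  from has_derivative_compose[OF this assms]
  have "((\<lambda>s. F (x + s *\<^sub>R e)) has_derivative (\<lambda>s. F' (s *\<^sub>R e))) (at t)" .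
  moreover have "(\<lambda>s. F' (s *\<^sub>R e)) = (*) (F' e)"
    using linear_scale[OF has_derivative_linear[OF assms]] by (simp add: fun_eq_iff)
  ultimately show ?thesis by (simp add: has_field_derivative_def)
qed

text \<open>Translation invariance makes the integrals of the difference quotients vanish.\<close>

lemma integral_directional_derivative_eq_0:
  fixes F :: "'a::euclidean_space \<Rightarrow> real"
  assumes der: "\<And>x. (F has_derivative F' x) (at x)"
    and cont: "continuous_on UNIV (\<lambda>x. F' x e)"
    and K: "compact K" and supp: "\<And>x. x \<notin> K \<Longrightarrow> F x = 0"
  shows "(LINT x|lebesgue. F' x e) = 0"
proof -
  have contF: "continuous_on UNIV F"
    using der by (auto intro: continuous_at_imp_continuous_on dest: has_derivative_continuous)
  have mF: "F \<in> borel_measurable borel" and mD: "(\<lambda>x. F' x e) \<in> borel_measurable borel"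
    using contF cont by (auto intro: borel_measurable_continuous_onI)
  have D0: "F' x e = 0" if "x \<notin> K" for x
  proof -
    have "((\<lambda>_. 0) has_derivative (\<lambda>_. 0)) (at x)" by simp
    then have "(F has_derivative (\<lambda>_. 0)) (at x)"
      by (rule has_derivative_transform_within_open[of _ _ _ _ "- K"])
        (use that supp K in \<open>auto simp: compact_imp_closed open_Compl\<close>)
    from has_derivative_unique[OF der this] show ?thesis by simp
  qed
  obtain C where C: "C > 0" "\<And>x. x \<in> K \<Longrightarrow> norm (F' x e) \<le> C"
    using compact_imp_bounded[OF compact_continuous_image[OF continuous_on_subset[OF cont subset_UNIV] K]]
    by (auto simp: bounded_pos)
  have C': "\<bar>F' x e\<bar> \<le> C" for x
    using C D0[of x] by (cases "x \<in> K") auto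
  obtain R where R: "\<And>x. x \<in> K \<Longrightarrow> norm x \<le> R"
    using compact_imp_bounded[OF K] by (auto simp: bounded_iff)
  \<comment> \<open>Since the step \<open>h m\<close> is at most 1, both end points of a difference
    quotient miss \<open>K\<close> once \<open>x\<close> leaves this ball. Inside it the mean value
    theorem bounds the quotients by \<open>C\<close>, so one integrable function dominates them
    all.\<close>
  define B where "B = cball (0::'a) (R + norm e)"
  define h where "h m = inverse (real (Suc m))" for m
  have h: "0 < h m" "h m \<le> 1" for m by (auto simp: h_def field_simps)
  define q where "q m x = (F (x + h m *\<^sub>R e) - F x) / h m" for m x
  have line: "((\<lambda>s. F (x + s *\<^sub>R e)) has_real_derivative F' (x + t *\<^sub>R e) e) (at t)" for x t
    by (rule has_derivative_line[OF der])
  have mFt: "(\<lambda>x. F (x + c)) \<in> borel_measurable borel" for c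
    using mF by measurable
  have lim: "(\<lambda>m. q m x) \<longlonglongrightarrow> F' x e" for x
  proof -
    have "((\<lambda>s. (F (x + s *\<^sub>R e) - F x) / s) \<longlongrightarrow> F' x e) (at 0)"
      using line[of x 0] by (simp add: DERIV_def)
    moreover have "filterlim h (at 0) sequentially"
      using LIMSEQ_inverse_real_of_nat h(1)
      by (auto simp: filterlim_at h_def[abs_def] intro!: always_eventually)
    ultimately show ?thesis
      unfolding q_def by (rule filterlim_compose)
  qed
  have bound: "norm (q m x) \<le> C * indicator B x" for m x
  proof (cases "x \<in> B")
    case True
    obtain z where "0 < z" "z < h m" "F (x + h m *\<^sub>R e) - F (x + 0 *\<^sub>R e) = (h m - 0) * F' (x + z *\<^sub>R e) e"
      using MVT2[of 0 "h m" "\<lambda>s. F (x + s *\<^sub>R e)" "\<lambda>s. F' (x + s *\<^sub>R e) e"] h(1) line by blast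
    then have "q m x = F' (x + z *\<^sub>R e) e" using h[of m] by (simp add: q_def)
    then show ?thesis using True C' by simp
  next
    case False
    have "x \<notin> K" using False R[of x] by (auto simp: B_def) (smt (verit) norm_ge_zero)
    moreover have "x + h m *\<^sub>R e \<notin> K"
    proof
      assume "x + h m *\<^sub>R e \<in> K"
      then have "norm (x + h m *\<^sub>R e) \<le> R" by (rule R)
      moreover have "norm (h m *\<^sub>R e) \<le> norm e" using h[of m] by (simp add: mult_left_le_one_le)
      moreover have "norm x \<le> norm (x + h m *\<^sub>R e) + norm (h m *\<^sub>R e)"
        using norm_triangle_ineq4[of "x + h m *\<^sub>R e" "h m *\<^sub>R e"] by simp
      ultimately show False using False by (simp add: B_def)
    qed
    ultimately show ?thesis using False supp by (simp add: q_def)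
  qed
  have intF: "integrable lborel F"
  proof -
    have "integrable lborel (\<lambda>x. indicator K x *\<^sub>R F x)"
      by (rule borel_integrable_compact[OF K]) (rule continuous_on_subset[OF contF subset_UNIV])
    moreover have "(\<lambda>x. indicator K x *\<^sub>R F x) = F"
      using supp by (auto simp: fun_eq_iff indicator_def)
    ultimately show ?thesis by simp
  qed
  have q0: "(LINT x|lborel. q m x) = 0" for m
  proof -
    have tr: "distr lborel borel (\<lambda>x. x + h m *\<^sub>R e) = lborel"
      using lborel_distr_plus[of "h m *\<^sub>R e"] by (simp add: add.commute[of _ "h m *\<^sub>R e"])
    have 1: "integrable lborel (\<lambda>x. F (x + h m *\<^sub>R e))"
      using integrable_distr_eq[of "\<lambda>x. x + h m *\<^sub>R e" lborel borel F] tr mF intF by simp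
    have 2: "(LINT x|lborel. F (x + h m *\<^sub>R e)) = (LINT x|lborel. F x)"
      using integral_distr[of "\<lambda>x. x + h m *\<^sub>R e" lborel borel F] tr mF by simp
    show ?thesis unfolding q_def using 1 2 intF by simp
  qed
  have "(\<lambda>m. LINT x|lborel. q m x) \<longlonglongrightarrow> (LINT x|lborel. F' x e)"
  proof (rule integral_dominated_convergence[where w = "\<lambda>x. C * indicator B x"])
    show "integrable lborel (\<lambda>x. C * indicator B x)"
      unfolding B_def by (intro integrable_mult_right integrable_real_indicator) 
        (use emeasure_lborel_cball_finite[of "0::'a" "R + norm e"] in auto)
    show "q m \<in> borel_measurable lborel" for m
      unfolding q_def using mF mFt by measurable
  qed (use mD lim bound in auto)
  then have "(LINT x|lborel. F' x e) = 0" by (simp add: q0 LIMSEQ_const_iff)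
  then show ?thesis using mD by (simp add: integral_completion)
qed

section \<open>Differences, multiples and supports of test functions\<close>

lemma frechet_derivative_eq: "(f has_derivative f') (at x) \<Longrightarrow> frechet_derivative f (at x) = f'"
  using frechet_derivative_at by metis

lemma Ck_diff: "Ck k f \<Longrightarrow> Ck k g \<Longrightarrow> Ck k (\<lambda>x. f x - g x)"
proof (induction k arbitrary: f g)
  case 0
  then show ?case by (auto intro: continuous_intros)
next
  case (Suc k)
  then have f: "\<And>x. f differentiable (at x)" and g: "\<And>x. g differentiable (at x)" by auto
  have "frechet_derivative (\<lambda>x. f x - g x) (at x) =
      (\<lambda>v. frechet_derivative f (at x) v - frechet_derivative g (at x) v)" for x
    by (intro frechet_derivative_eq has_derivative_diff)
      (use f g frechet_derivative_works in blast)+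
  moreover have "Ck k (\<lambda>x. frechet_derivative f (at x) (axis j 1) - frechet_derivative g (at x) (axis j 1))" for j
    using Suc.prems by (intro Suc.IH) auto
  ultimately show ?case using f g by simp
qed

lemma Ck_scaleR: "Ck k f \<Longrightarrow> Ck k (\<lambda>x. c *\<^sub>R f x)"
proof (induction k arbitrary: f)
  case 0
  then show ?case by (auto intro: continuous_intros)
next
  case (Suc k)
  then have f: "\<And>x. f differentiable (at x)" by auto
  have "frechet_derivative (\<lambda>x. c *\<^sub>R f x) (at x) = (\<lambda>v. c *\<^sub>R frechet_derivative f (at x) v)" for x
    by (intro frechet_derivative_eq has_derivative_scaleR_right)
      (use f frechet_derivative_works in blast)
  moreover have "Ck k (\<lambda>x. c *\<^sub>R frechet_derivative f (at x) (axis j 1))" for j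
    using Suc.prems by (intro Suc.IH) auto
  ultimately show ?case using f by simp
qed

lemma Cc_infty_diff:
  assumes f: "f \<in> Cc_infty \<Omega>" and g: "g \<in> Cc_infty \<Omega>"
  shows "(\<lambda>x. f x - g x) \<in> Cc_infty \<Omega>"
proof -
  let ?K = "closure {x. f x \<noteq> 0} \<union> closure {x. g x \<noteq> 0}"
  have K: "compact ?K" "?K \<subseteq> \<Omega>" using f g by (auto simp: Cc_infty_def)
  have sub: "closure {x. f x - g x \<noteq> 0} \<subseteq> ?K"
    unfolding closure_Un[symmetric] by (rule closure_mono) auto
  have "compact (?K \<inter> closure {x. f x - g x \<noteq> 0})"
    using K by (intro compact_Int_closed) auto
  with sub have "compact (closure {x. f x - g x \<noteq> 0})" by (simp add: Int_absorb1)
  with sub K f g show ?thesis by (auto simp: Cc_infty_def intro!: Ck_diff)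
qed

lemma Cc_infty_scaleR:
  assumes f: "f \<in> Cc_infty \<Omega>"
  shows "(\<lambda>x. c *\<^sub>R f x) \<in> Cc_infty \<Omega>"
proof -
  let ?K = "closure {x. f x \<noteq> 0}"
  have K: "compact ?K" "?K \<subseteq> \<Omega>" using f by (auto simp: Cc_infty_def)
  have sub: "closure {x. c *\<^sub>R f x \<noteq> 0} \<subseteq> ?K"
    by (rule closure_mono) auto
  have "compact (?K \<inter> closure {x. c *\<^sub>R f x \<noteq> 0})"
    using K by (intro compact_Int_closed) auto
  with sub have "compact (closure {x. c *\<^sub>R f x \<noteq> 0})" by (simp add: Int_absorb1)
  with sub K f show ?thesis by (auto simp: Cc_infty_def intro!: Ck_scaleR)
qed

lemma Cc_infty_Ck: "\<phi> \<in> Cc_infty \<Omega> \<Longrightarrow> Ck k \<phi>"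
  by (simp add: Cc_infty_def)

lemma Cc_infty_continuous: "\<phi> \<in> Cc_infty \<Omega> \<Longrightarrow> continuous_on S \<phi>"
  by (rule continuous_on_subset[OF Ck_imp_continuous[OF Cc_infty_Ck] subset_UNIV])

lemma Cc_infty_has_derivative:
  "\<phi> \<in> Cc_infty \<Omega> \<Longrightarrow> (\<phi> has_derivative frechet_derivative \<phi> (at x)) (at x)"
  using Cc_infty_Ck[of \<phi> \<Omega> "Suc 0"] by (simp add: frechet_derivative_works)

lemma Cc_infty_partial_continuous:
  "\<phi> \<in> Cc_infty \<Omega> \<Longrightarrow> continuous_on S (\<lambda>x. frechet_derivative \<phi> (at x) (axis j 1))"
  using Cc_infty_Ck[of \<phi> \<Omega> "Suc 0"] by (auto intro: continuous_on_subset[OF _ subset_UNIV])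

lemma Cc_infty_outside:
  assumes \<phi>: "\<phi> \<in> Cc_infty \<Omega>" and x: "x \<notin> closure {x. \<phi> x \<noteq> 0}"
  shows "\<phi> x = 0" "frechet_derivative \<phi> (at x) = (\<lambda>_. 0)"
proof -
  have zero: "\<phi> y = 0" if "y \<notin> closure {x. \<phi> x \<noteq> 0}" for y
    using that closure_subset[of "{x. \<phi> x \<noteq> 0}"] by auto
  then show "\<phi> x = 0" using x by blast
  have "((\<lambda>_. 0) has_derivative (\<lambda>_. 0)) (at x)" by simp
  then have "(\<phi> has_derivative (\<lambda>_. 0)) (at x)"
  proof (rule has_derivative_transform_within_open)
    show "open (- closure {x. \<phi> x \<noteq> 0})" by (rule open_Compl[OF closed_closure])
    show "x \<in> - closure {x. \<phi> x \<noteq> 0}" using x by simp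
    show "0 = \<phi> y" if "y \<in> - closure {x. \<phi> x \<noteq> 0}" for y
      using zero[of y] that by (metis ComplD)
  qed
  then show "frechet_derivative \<phi> (at x) = (\<lambda>_. 0)" by (rule frechet_derivative_eq)
qed

lemma Cc_infty_outside_domain:
  assumes \<phi>: "\<phi> \<in> Cc_infty \<Omega>" and x: "x \<notin> \<Omega>"
  shows "\<phi> x = 0" "frechet_derivative \<phi> (at x) = (\<lambda>_. 0)"
proof -
  have "x \<notin> closure {x. \<phi> x \<noteq> 0}" using x \<phi> by (auto simp: Cc_infty_def)
  from Cc_infty_outside[OF \<phi> this]
  show "\<phi> x = 0" "frechet_derivative \<phi> (at x) = (\<lambda>_. 0)" .
qed

text \<open>\<open>T\<close> extracts a component of a vector-valued test function. The product of
  \<open>T (\<phi> x)\<close> and \<open>\<psi> x\<close> is compactly supported, so its partial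
  derivative integrates to zero. The aim is that classical partial derivatives of smooth fields are
  weak ones.\<close>

lemma integration_by_parts_Cc_infty:
  fixes \<phi> :: "real^'n \<Rightarrow> 'b::euclidean_space" and \<psi> :: "real^'n \<Rightarrow> real"
  assumes \<phi>: "\<phi> \<in> Cc_infty \<Omega>" and \<psi>: "\<psi> \<in> Cc_infty \<Omega>" and \<Omega>: "open \<Omega>"
    and T: "bounded_linear (T :: 'b \<Rightarrow> real)"
  shows "(LINT x|lebesgue_on \<Omega>. T (\<phi> x) * frechet_derivative \<psi> (at x) (axis j 1)) =
       - (LINT x|lebesgue_on \<Omega>. T (frechet_derivative \<phi> (at x) (axis j 1)) * \<psi> x)"
proof -
  let ?e = "axis j (1::real) :: real^'n"
  let ?D\<phi> = "\<lambda>x. frechet_derivative \<phi> (at x)" and ?D\<psi> = "\<lambda>x. frechet_derivative \<psi> (at x)"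
  let ?K = "closure {x. \<psi> x \<noteq> 0}"
  have K: "compact ?K" "?K \<subseteq> \<Omega>" using \<psi> by (auto simp: Cc_infty_def)
  have sets: "\<Omega> \<in> sets lebesgue" using \<Omega> by auto
  have contT: "continuous_on S (\<lambda>x. T (g x))" if "continuous_on S g" for S :: "(real^'n) set" and g
    by (rule bounded_linear.continuous_on[OF T that])
  note cont = contT[OF Cc_infty_continuous[OF \<phi>]] contT[OF Cc_infty_partial_continuous[OF \<phi>]]
    Cc_infty_continuous[OF \<psi>] Cc_infty_partial_continuous[OF \<psi>]
  have c1: "continuous_on S (\<lambda>x. T (\<phi> x) * ?D\<psi> x ?e)" and c2: "continuous_on S (\<lambda>x. T (?D\<phi> x ?e) * \<psi> x)" for S
    by (rule continuous_on_mult[OF cont(1) cont(4)], rule continuous_on_mult[OF cont(2) cont(3)])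
  have int: "integrable lebesgue f" if "continuous_on UNIV f" "\<And>x. x \<notin> ?K \<Longrightarrow> f x = 0" for f :: "real^'n \<Rightarrow> real"
  proof -
    have "integrable lborel (\<lambda>x. indicator ?K x *\<^sub>R f x)"
      by (rule borel_integrable_compact[OF K(1)]) (rule continuous_on_subset[OF that(1) subset_UNIV])
    moreover have "(\<lambda>x. indicator ?K x *\<^sub>R f x) = f"
    proof
      fix x show "indicator ?K x *\<^sub>R f x = f x"
      proof (cases "x \<in> ?K")
        case True
        then show ?thesis by (simp only: indicator_simps scaleR_one)
      next
        case False
        with that(2)[OF False] show ?thesis by (simp only: scaleR_zero_right)
      qed
    qed
    ultimately show ?thesis
      using that(1) by (simp add: integrable_completion borel_measurable_continuous_onI)
  qed
  have restr: "(LINT x|lebesgue_on \<Omega>. f x) = (LINT x|lebesgue. f x)" if "\<And>x. x \<notin> \<Omega> \<Longrightarrow> f x = 0" for f :: "real^'n \<Rightarrow> real"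
  proof -
    have "(LINT x|lebesgue_on \<Omega>. f x) = (LINT x|lebesgue. indicator \<Omega> x *\<^sub>R f x)"
      using sets by (intro integral_restrict_space) auto
    also have "(\<lambda>x. indicator \<Omega> x *\<^sub>R f x) = f"
      using that by (auto simp: fun_eq_iff indicator_def)
    finally show ?thesis .
  qed
  have "(LINT x|lebesgue. T (\<phi> x) * ?D\<psi> x ?e + T (?D\<phi> x ?e) * \<psi> x) = 0"
  proof (rule integral_directional_derivative_eq_0[of "\<lambda>x. T (\<phi> x) * \<psi> x"
        "\<lambda>x v. T (\<phi> x) * ?D\<psi> x v + T (?D\<phi> x v) * \<psi> x" _ ?K])
    show "((\<lambda>x. T (\<phi> x) * \<psi> x) has_derivative (\<lambda>v. T (\<phi> x) * ?D\<psi> x v + T (?D\<phi> x v) * \<psi> x)) (at x)" for x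
      by (intro has_derivative_mult bounded_linear.has_derivative[OF T]
          Cc_infty_has_derivative[OF \<phi>] Cc_infty_has_derivative[OF \<psi>])
    show "continuous_on UNIV (\<lambda>x. T (\<phi> x) * ?D\<psi> x ?e + T (?D\<phi> x ?e) * \<psi> x)"
      by (intro continuous_on_add c1 c2)
    show "T (\<phi> x) * \<psi> x = 0" if "x \<notin> ?K" for x
      using Cc_infty_outside(1)[OF \<psi> that] by (simp only: mult_zero_right)
  qed (rule K(1))
  moreover have "integrable lebesgue (\<lambda>x. T (\<phi> x) * ?D\<psi> x ?e)"
    by (rule int[OF c1]) (subst Cc_infty_outside(2)[OF \<psi>], assumption, rule mult_zero_right)
  moreover have "integrable lebesgue (\<lambda>x. T (?D\<phi> x ?e) * \<psi> x)"
    by (rule int[OF c2]) (subst Cc_infty_outside(1)[OF \<psi>], assumption, rule mult_zero_right)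
  ultimately have "(LINT x|lebesgue. T (\<phi> x) * ?D\<psi> x ?e) = - (LINT x|lebesgue. T (?D\<phi> x ?e) * \<psi> x)"
    by simp
  then show ?thesis
    by (simp add: restr Cc_infty_outside_domain[OF \<psi>])
qed

subsection \<open>Weak gradients on bounded open sets\<close>

text \<open>Boundedness has two uses: finite measure, which puts L2 inside L1, and compactness of
  the closure, which makes finite element functions bounded. It is supplied by the mesh, whose
  finitely many compact simplices cover the closure.\<close>

locale bounded_open =
  fixes \<Omega> :: "(real^'n) set"
  assumes open_domain: "open \<Omega>" and bounded_domain: "bounded \<Omega>"
begin

lemma domain_sets: "\<Omega> \<in> sets lebesgue"
  using open_domain by auto

lemma finite_measure_domain: "finite_measure (lebesgue_on \<Omega>)"
  using open_domain bounded_domain by (intro finite_measure_lebesgue_on lmeasurable_open)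

lemma integrable_const_domain: "integrable (lebesgue_on \<Omega>) (\<lambda>_. c :: real)"
  by (rule finite_measure.integrable_const[OF finite_measure_domain])

lemma continuous_measurable:
  "continuous_on (closure \<Omega>) f \<Longrightarrow> f \<in> borel_measurable (lebesgue_on \<Omega>)"
  by (rule continuous_imp_measurable_on_sets_lebesgue[OF continuous_on_subset[OF _ closure_subset] domain_sets])

lemma continuous_bounded:
  fixes f :: "real^'n \<Rightarrow> 'b::euclidean_space"
  assumes "continuous_on (closure \<Omega>) f"
  shows "\<exists>C. \<forall>x\<in>\<Omega>. norm (f x) \<le> C"
proof -
  have "compact (closure \<Omega>)" using bounded_domain by (simp add: compact_closure)
  from compact_imp_bounded[OF compact_continuous_image[OF assms this]]
  obtain C where "\<forall>x\<in>closure \<Omega>. norm (f x) \<le> C" by (auto simp: bounded_iff)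
  then show ?thesis using closure_subset[of \<Omega>] by (intro exI[of _ C]) (meson subsetD)
qed

lemma continuous_L2:
  fixes f :: "real^'n \<Rightarrow> 'b::euclidean_space"
  assumes "continuous_on (closure \<Omega>) f"
  shows "f \<in> L2 \<Omega>"
proof -
  obtain C where C: "\<forall>x\<in>\<Omega>. norm (f x) \<le> C" using continuous_bounded[OF assms] ..
  have "integrable (lebesgue_on \<Omega>) (\<lambda>x. (norm (f x))\<^sup>2)"
  proof (rule finite_measure.integrable_const_bound[OF finite_measure_domain])
    show "AE x in lebesgue_on \<Omega>. norm ((norm (f x))\<^sup>2) \<le> C\<^sup>2"
      by (rule AE_I2) (simp add: C power_mono)
    show "(\<lambda>x. (norm (f x))\<^sup>2) \<in> borel_measurable (lebesgue_on \<Omega>)"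
      using continuous_measurable[OF assms] by measurable
  qed
  with continuous_measurable[OF assms] show ?thesis by (simp add: L2_def)
qed

lemma L2_integrable:
  assumes "f \<in> L2 \<Omega>"
  shows "integrable (lebesgue_on \<Omega>) f"
proof (rule Bochner_Integration.integrable_bound)
  show "integrable (lebesgue_on \<Omega>) (\<lambda>x. 1 + (norm (f x))\<^sup>2)"
    using L2_square_integrable[OF assms] integrable_const_domain by simp
  have "t \<le> 1 + t\<^sup>2" for t :: real
    using sum_squares_bound[of t 1] zero_le_power2[of t] by (cases "0 \<le> t"; simp; linarith)
  then show "AE x in lebesgue_on \<Omega>. norm (f x) \<le> norm (1 + (norm (f x))\<^sup>2)"
    by (auto simp: add_nonneg_nonneg)
qed (rule L2_measurable[OF assms])

lemma L2_mult_integrable: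
  fixes f g :: "real^'n \<Rightarrow> real"
  shows "f \<in> L2 \<Omega> \<Longrightarrow> g \<in> L2 \<Omega> \<Longrightarrow> integrable (lebesgue_on \<Omega>) (\<lambda>x. f x * g x)"
  using L2_inner_integrable[of f \<Omega> g] by simp

lemma L2_vec_nth: "f \<in> L2 \<Omega> \<Longrightarrow> (\<lambda>x. f x $ i) \<in> L2 \<Omega>"
  by (rule L2_bounded_linear[OF _ bounded_linear_vec_nth])

lemma Cc_infty_L2: "\<phi> \<in> Cc_infty \<Omega> \<Longrightarrow> \<phi> \<in> L2 \<Omega>"
  by (intro continuous_L2 Cc_infty_continuous)

lemma Cc_infty_partial_L2: "\<phi> \<in> Cc_infty \<Omega> \<Longrightarrow> (\<lambda>x. frechet_derivative \<phi> (at x) (axis j 1)) \<in> L2 \<Omega>"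
  by (intro continuous_L2 Cc_infty_partial_continuous)

lemma weak_grad_L2: "is_weak_grad \<Omega> v g \<Longrightarrow> g \<in> L2 \<Omega>"
  by (simp add: is_weak_grad_def)

text \<open>The fundamental lemma is applied to each entry of the difference; the finitely many
  exceptional null sets combine into one.\<close>

lemma weak_grad_unique:
  assumes g: "is_weak_grad \<Omega> v g" and h: "is_weak_grad \<Omega> v h"
  shows "AE x in lebesgue_on \<Omega>. g x = h x"
proof -
  have L2: "(\<lambda>x. g x $ i $ j) \<in> L2 \<Omega>" "(\<lambda>x. h x $ i $ j) \<in> L2 \<Omega>" for i j
    using weak_grad_L2[OF g] weak_grad_L2[OF h] by (auto intro!: L2_vec_nth)
  have "AE x in lebesgue_on \<Omega>. g x $ i $ j - h x $ i $ j = 0" for i j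
  proof (rule fundamental_lemma_calculus_of_variations[OF open_domain])
    show "integrable (lebesgue_on \<Omega>) (\<lambda>x. g x $ i $ j - h x $ i $ j)"
      by (intro L2_integrable L2_diff L2)
    fix \<phi> :: "real^'n \<Rightarrow> real" assume \<phi>: "\<phi> \<in> Cc_infty \<Omega>"
    have "(LINT x|lebesgue_on \<Omega>. g x $ i $ j * \<phi> x) = (LINT x|lebesgue_on \<Omega>. h x $ i $ j * \<phi> x)"
      using g h \<phi> by (simp add: is_weak_grad_def)
    then show "(LINT x|lebesgue_on \<Omega>. (g x $ i $ j - h x $ i $ j) * \<phi> x) = 0"
      using L2_mult_integrable[OF L2(1) Cc_infty_L2[OF \<phi>]] L2_mult_integrable[OF L2(2) Cc_infty_L2[OF \<phi>]]
      by (simp add: left_diff_distrib)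
  qed
  then have "AE x in lebesgue_on \<Omega>. \<forall>i j. g x $ i $ j - h x $ i $ j = 0"
    by (simp add: AE_all_countable)
  then show ?thesis by eventually_elim (simp add: vec_eq_iff)
qed

lemma weak_grad_diff:
  assumes v: "v \<in> L2 \<Omega>" "is_weak_grad \<Omega> v g" and w: "w \<in> L2 \<Omega>" "is_weak_grad \<Omega> w h"
  shows "is_weak_grad \<Omega> (\<lambda>x. v x - w x) (\<lambda>x. g x - h x)"
  unfolding is_weak_grad_def
proof (intro conjI ballI allI)
  show "(\<lambda>x. g x - h x) \<in> L2 \<Omega>" using v w weak_grad_L2 L2_diff by blast
  fix \<phi> :: "real^'n \<Rightarrow> real" and i j assume \<phi>: "\<phi> \<in> Cc_infty \<Omega>"
  let ?d = "\<lambda>x. frechet_derivative \<phi> (at x) (axis j 1)"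
  have "integrable (lebesgue_on \<Omega>) (\<lambda>x. v x $ i * ?d x)" "integrable (lebesgue_on \<Omega>) (\<lambda>x. w x $ i * ?d x)"
    "integrable (lebesgue_on \<Omega>) (\<lambda>x. g x $ i $ j * \<phi> x)" "integrable (lebesgue_on \<Omega>) (\<lambda>x. h x $ i $ j * \<phi> x)"
    by (intro L2_mult_integrable L2_vec_nth Cc_infty_L2 Cc_infty_partial_L2 \<phi> v w weak_grad_L2[OF v(2)]
        weak_grad_L2[OF w(2)])+
  then show "(LINT x|lebesgue_on \<Omega>. (v x - w x) $ i * ?d x) = - (LINT x|lebesgue_on \<Omega>. (g x - h x) $ i $ j * \<phi> x)"
    using v(2) w(2) \<phi> by (simp add: is_weak_grad_def left_diff_distrib)
qed

lemma weak_grad_scaleR: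
  assumes "is_weak_grad \<Omega> v g"
  shows "is_weak_grad \<Omega> (\<lambda>x. c *\<^sub>R v x) (\<lambda>x. c *\<^sub>R g x)"
  using assms L2_scaleR by (auto simp: is_weak_grad_def mult.assoc)

section \<open>Almost-everywhere linearity of the chosen gradient\<close>

lemma grad_is_weak_grad: "v \<in> H1 \<Omega> \<Longrightarrow> is_weak_grad \<Omega> v (grad \<Omega> v)"
  unfolding H1_def grad_def using someI_ex[of "is_weak_grad \<Omega> v"] by simp

lemma H1_L2: "v \<in> H1 \<Omega> \<Longrightarrow> v \<in> L2 \<Omega>"
  by (simp add: H1_def)

lemma grad_L2: "v \<in> H1 \<Omega> \<Longrightarrow> grad \<Omega> v \<in> L2 \<Omega>"
  by (rule weak_grad_L2[OF grad_is_weak_grad])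

lemma divg_L2: "v \<in> H1 \<Omega> \<Longrightarrow> divg \<Omega> v \<in> L2 \<Omega>"
proof -
  have "linear (trace :: real^'n^'n \<Rightarrow> real)"
    by (rule linearI) (auto simp: trace_def sum.distrib sum_distrib_left)
  then show "v \<in> H1 \<Omega> \<Longrightarrow> divg \<Omega> v \<in> L2 \<Omega>"
    unfolding divg_def by (intro L2_bounded_linear[OF grad_L2]) (auto simp: linear_conv_bounded_linear)
qed

lemma H1_diff: "v \<in> H1 \<Omega> \<Longrightarrow> w \<in> H1 \<Omega> \<Longrightarrow> (\<lambda>x. v x - w x) \<in> H1 \<Omega>"
  using weak_grad_diff L2_diff unfolding H1_def by blast

lemma H1_scaleR: "v \<in> H1 \<Omega> \<Longrightarrow> (\<lambda>x. c *\<^sub>R v x) \<in> H1 \<Omega>"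
  using weak_grad_scaleR L2_scaleR unfolding H1_def by blast

lemma grad_diff:
  assumes "v \<in> H1 \<Omega>" "w \<in> H1 \<Omega>"
  shows "AE x in lebesgue_on \<Omega>. grad \<Omega> (\<lambda>x. v x - w x) x = grad \<Omega> v x - grad \<Omega> w x"
  using assms by (intro weak_grad_unique[OF grad_is_weak_grad weak_grad_diff]
      grad_is_weak_grad H1_diff H1_L2)

lemma grad_scaleR:
  assumes "v \<in> H1 \<Omega>"
  shows "AE x in lebesgue_on \<Omega>. grad \<Omega> (\<lambda>x. c *\<^sub>R v x) x = c *\<^sub>R grad \<Omega> v x"
  using assms by (intro weak_grad_unique[OF grad_is_weak_grad weak_grad_scaleR]
      grad_is_weak_grad H1_scaleR)

lemma divg_diff:
  assumes "v \<in> H1 \<Omega>" "w \<in> H1 \<Omega>"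
  shows "AE x in lebesgue_on \<Omega>. divg \<Omega> (\<lambda>x. v x - w x) x = divg \<Omega> v x - divg \<Omega> w x"
  using grad_diff[OF assms] by eventually_elim (simp add: divg_def trace_sub)

lemma l2_norm_grad_diff:
  assumes "v \<in> H1 \<Omega>" "w \<in> H1 \<Omega>"
  shows "l2_norm \<Omega> (grad \<Omega> (\<lambda>x. v x - w x)) = l2_norm \<Omega> (\<lambda>x. grad \<Omega> v x - grad \<Omega> w x)"
  using assms by (intro l2_norm_cong_AE grad_diff L2_diff grad_L2 H1_diff)

lemma l2_norm_grad_scaleR:
  assumes "v \<in> H1 \<Omega>"
  shows "l2_norm \<Omega> (grad \<Omega> (\<lambda>x. c *\<^sub>R v x)) = \<bar>c\<bar> * l2_norm \<Omega> (grad \<Omega> v)"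
proof -
  have "l2_norm \<Omega> (grad \<Omega> (\<lambda>x. c *\<^sub>R v x)) = l2_norm \<Omega> (\<lambda>x. c *\<^sub>R grad \<Omega> v x)"
    using assms by (intro l2_norm_cong_AE grad_scaleR L2_scaleR grad_L2 H1_scaleR)
  then show ?thesis by (simp add: l2_norm_scaleR)
qed

text \<open>\<open>H10\<close> is defined through \<open>h1_norm\<close> of test fields minus the
  limit, which contains a chosen gradient. Only once test fields are known to lie in
  \<open>H1\<close> can that gradient be computed with.\<close>

lemma Cc_infty_H1:
  fixes \<phi> :: "'n vfield"
  assumes "\<phi> \<in> Cc_infty \<Omega>"
  shows "\<phi> \<in> H1 \<Omega>"
proof -
  let ?g = "\<lambda>x. (\<chi> i j. frechet_derivative \<phi> (at x) (axis j 1) $ i) :: real^'n^'n"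
  have "?g \<in> L2 \<Omega>"
    by (intro continuous_L2 continuous_on_vec_lambda
        bounded_linear.continuous_on[OF bounded_linear_vec_nth] Cc_infty_partial_continuous[OF assms])
  then have "is_weak_grad \<Omega> \<phi> ?g"
    unfolding is_weak_grad_def
    using integration_by_parts_Cc_infty[OF assms _ open_domain bounded_linear_vec_nth] by simp
  then show ?thesis using Cc_infty_L2[OF assms] by (auto simp: H1_def)
qed

section \<open>The space \<open>H10\<close> and its dual\<close>

lemma h1_norm_nonneg: "0 \<le> h1_norm \<Omega> v"
  by (simp add: h1_norm_def)

text \<open>Cruder than the triangle inequality, but it follows termwise from the bound on squares
  and is enough to pass null sequences on to their differences.\<close>

lemma h1_norm_diff_le:
  assumes v: "v \<in> H1 \<Omega>" and w: "w \<in> H1 \<Omega>"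
  shows "h1_norm \<Omega> (\<lambda>x. v x - w x) \<le> sqrt (2 * (h1_norm \<Omega> v)\<^sup>2 + 2 * (h1_norm \<Omega> w)\<^sup>2)"
  unfolding h1_norm_def[of _ "\<lambda>x. v x - w x"]
  using l2_norm_diff_square_le[OF H1_L2[OF v] H1_L2[OF w]]
    l2_norm_diff_square_le[OF grad_L2[OF v] grad_L2[OF w]]
  by (intro real_sqrt_le_mono) (simp add: l2_norm_grad_diff[OF v w] h1_norm_def)

lemma h1_norm_scaleR:
  assumes "v \<in> H1 \<Omega>"
  shows "h1_norm \<Omega> (\<lambda>x. c *\<^sub>R v x) = \<bar>c\<bar> * h1_norm \<Omega> v"
proof -
  have "h1_norm \<Omega> (\<lambda>x. c *\<^sub>R v x) = sqrt (c\<^sup>2 * ((l2_norm \<Omega> v)\<^sup>2 + (l2_norm \<Omega> (grad \<Omega> v))\<^sup>2))"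
    unfolding h1_norm_def l2_norm_grad_scaleR[OF assms] l2_norm_scaleR
    by (simp only: power_mult_distrib power2_abs distrib_left)
  then show ?thesis by (simp only: real_sqrt_mult real_sqrt_abs h1_norm_def)
qed

lemma H10_H1: "v \<in> H10 \<Omega> \<Longrightarrow> v \<in> H1 \<Omega>"
  by (simp add: H10_def)

lemma H10_diff:
  assumes v: "v \<in> H10 \<Omega>" and w: "w \<in> H10 \<Omega>"
  shows "(\<lambda>x. v x - w x) \<in> H10 \<Omega>"
proof -
  obtain \<phi> where \<phi>: "\<And>m. \<phi> m \<in> Cc_infty \<Omega>" "(\<lambda>m. h1_norm \<Omega> (\<lambda>x. \<phi> m x - v x)) \<longlonglongrightarrow> 0"
    using v by (auto simp: H10_def)
  obtain \<psi> where \<psi>: "\<And>m. \<psi> m \<in> Cc_infty \<Omega>" "(\<lambda>m. h1_norm \<Omega> (\<lambda>x. \<psi> m x - w x)) \<longlonglongrightarrow> 0"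
    using w by (auto simp: H10_def)
  let ?a = "\<lambda>m x. \<phi> m x - v x" and ?b = "\<lambda>m x. \<psi> m x - w x"
  have ab: "?a m \<in> H1 \<Omega>" "?b m \<in> H1 \<Omega>" for m
    by (rule H1_diff[OF Cc_infty_H1[OF \<phi>(1)] H10_H1[OF v]],
        rule H1_diff[OF Cc_infty_H1[OF \<psi>(1)] H10_H1[OF w]])
  have "(\<lambda>m. sqrt (2 * (h1_norm \<Omega> (?a m))\<^sup>2 + 2 * (h1_norm \<Omega> (?b m))\<^sup>2)) \<longlonglongrightarrow> sqrt (2 * 0\<^sup>2 + 2 * 0\<^sup>2)"
    by (intro tendsto_intros \<phi>(2) \<psi>(2))
  then have lim: "(\<lambda>m. sqrt (2 * (h1_norm \<Omega> (?a m))\<^sup>2 + 2 * (h1_norm \<Omega> (?b m))\<^sup>2)) \<longlonglongrightarrow> 0" by simp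
  have "(\<lambda>m. h1_norm \<Omega> (\<lambda>x. ?a m x - ?b m x)) \<longlonglongrightarrow> 0"
    by (rule tendsto_sandwich[OF _ _ tendsto_const lim])
      (use h1_norm_nonneg h1_norm_diff_le[OF ab] in auto)
  then have "(\<lambda>m. h1_norm \<Omega> (\<lambda>x. (\<phi> m x - \<psi> m x) - (v x - w x))) \<longlonglongrightarrow> 0"
    by (simp add: algebra_simps)
  moreover have "(\<lambda>x. \<phi> m x - \<psi> m x) \<in> Cc_infty \<Omega>" for m
    using \<phi>(1) \<psi>(1) by (rule Cc_infty_diff)
  ultimately show ?thesis
    using H1_diff[OF H10_H1[OF v] H10_H1[OF w]]
    by (auto simp: H10_def intro!: exI[of _ "\<lambda>m x. \<phi> m x - \<psi> m x"])
qed

lemma H10_scaleR: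
  assumes v: "v \<in> H10 \<Omega>"
  shows "(\<lambda>x. c *\<^sub>R v x) \<in> H10 \<Omega>"
proof -
  obtain \<phi> where \<phi>: "\<And>m. \<phi> m \<in> Cc_infty \<Omega>" "(\<lambda>m. h1_norm \<Omega> (\<lambda>x. \<phi> m x - v x)) \<longlonglongrightarrow> 0"
    using v by (auto simp: H10_def)
  have "(\<lambda>x. \<phi> m x - v x) \<in> H1 \<Omega>" for m
    by (rule H1_diff[OF Cc_infty_H1[OF \<phi>(1)] H10_H1[OF v]])
  then have "h1_norm \<Omega> (\<lambda>x. c *\<^sub>R \<phi> m x - c *\<^sub>R v x) = \<bar>c\<bar> * h1_norm \<Omega> (\<lambda>x. \<phi> m x - v x)" for m
    using h1_norm_scaleR[of "\<lambda>x. \<phi> m x - v x" c] by (simp add: scaleR_diff_right)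
  moreover have "(\<lambda>m. \<bar>c\<bar> * h1_norm \<Omega> (\<lambda>x. \<phi> m x - v x)) \<longlonglongrightarrow> 0"
    using tendsto_mult_left[OF \<phi>(2), of "\<bar>c\<bar>"] by simp
  ultimately have "(\<lambda>m. h1_norm \<Omega> (\<lambda>x. c *\<^sub>R \<phi> m x - c *\<^sub>R v x)) \<longlonglongrightarrow> 0" by simp
  then show ?thesis
    using H1_scaleR[OF H10_H1[OF v]] Cc_infty_scaleR[OF \<phi>(1)]
    by (auto simp: H10_def intro!: exI[of _ "\<lambda>m x. c *\<^sub>R \<phi> m x"])
qed

lemma dual_norm_bound:
  assumes f: "f \<in> H10_dual \<Omega>" and v: "v \<in> H10 \<Omega>"
  shows "f v \<le> dual_norm \<Omega> f * l2_norm \<Omega> (grad \<Omega> v)" and "0 \<le> dual_norm \<Omega> f"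
proof -
  let ?n = "\<lambda>v. l2_norm \<Omega> (grad \<Omega> v)" 
  let ?S = "{v \<in> H10 \<Omega>. ?n v \<le> 1}"
  obtain C where C: "\<forall>v\<in>H10 \<Omega>. \<bar>f v\<bar> \<le> C * ?n v" using f by (auto simp: H10_dual_def)
  have scale: "f (\<lambda>x. c *\<^sub>R v x) = c * f v" for c using f v by (simp add: H10_dual_def)
  \<comment> \<open>\<open>dual_norm\<close> is a supremum of reals and bounds its members only if
    the set is bounded above; the constant \<open>C\<close> from \<open>H10_dual\<close> provides
    this.\<close>
  have bdd: "bdd_above ((\<lambda>v. \<bar>f v\<bar>) ` ?S)"
  proof (rule bdd_aboveI2)
    fix w assume w: "w \<in> ?S"
    have "\<bar>f w\<bar> \<le> C * ?n w" using C w by simp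
    also have "\<dots> \<le> \<bar>C\<bar> * ?n w" by (intro mult_right_mono l2_norm_nonneg) auto
    also have "\<dots> \<le> \<bar>C\<bar>" using w by (intro mult_left_le) auto
    finally show "\<bar>f w\<bar> \<le> \<bar>C\<bar>" .
  qed
  have upper: "\<bar>f w\<bar> \<le> dual_norm \<Omega> f" if "w \<in> ?S" for w
    unfolding dual_norm_def by (rule cSUP_upper[OF that bdd])
  have *: "(\<lambda>x. c *\<^sub>R v x) \<in> ?S" if "\<bar>c\<bar> * ?n v \<le> 1" for c
    using that v by (simp add: H10_scaleR l2_norm_grad_scaleR H10_H1)
  show "0 \<le> dual_norm \<Omega> f"
    using upper[OF *[of 0]] by simp
  show "f v \<le> dual_norm \<Omega> f * ?n v"
  proof (cases "?n v = 0")
    \<comment> \<open>Normalisation is impossible here; the bound by \<open>C\<close> forces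
      \<open>f v\<close> to vanish.\<close>
    case True
    then show ?thesis using C v by fastforce
  next
    case False
    then have n: "?n v > 0" using l2_norm_nonneg[of \<Omega> "grad \<Omega> v"] by simp
    have "\<bar>f (\<lambda>x. (1 / ?n v) *\<^sub>R v x)\<bar> \<le> dual_norm \<Omega> f"
      using n by (intro upper *) simp
    then have "\<bar>f v\<bar> / ?n v \<le> dual_norm \<Omega> f"
      using n by (simp add: scale[simplified] abs_mult)
    then show ?thesis using n by (simp add: divide_le_eq)
  qed
qed

text \<open>The gradient is merely square integrable, so multiplying it by a field stays in L2 when
  that field is bounded; continuity on the compact closure gives this.\<close>

lemma bstar_integrand_L2:
  assumes v: "v \<in> H1 \<Omega>" and a: "continuous_on (closure \<Omega>) a"
  shows "(\<lambda>x. grad \<Omega> v x *v a x) \<in> L2 \<Omega>"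
proof -
  have "bilinear ((*v) :: real^'n^'n \<Rightarrow> _)"
    by (auto simp: bilinear_def intro!: linearI
        simp: matrix_vector_mult_add_rdistrib matrix_vector_right_distrib vector_scalar_commute
          scaleR_matrix_vector_assoc)
  then have B: "bounded_bilinear ((*v) :: real^'n^'n \<Rightarrow> _)"
    by (simp add: bilinear_conv_bounded_bilinear)
  obtain C where "\<forall>x\<in>\<Omega>. norm (a x) \<le> C" using continuous_bounded[OF a] ..
  then have "\<And>x. x \<in> \<Omega> \<Longrightarrow> norm (a x) \<le> C" by blast
  then show ?thesis
    by (intro L2_bounded_bilinear[OF grad_L2[OF v] continuous_measurable[OF a] _ B domain_sets])
qed

lemma bstar_diff_left:
  assumes "continuous_on (closure \<Omega>) a" "continuous_on (closure \<Omega>) b" "v \<in> H1 \<Omega>" "w \<in> H1 \<Omega>"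
  shows "bstar \<Omega> (\<lambda>x. a x - b x) v w = bstar \<Omega> a v w - bstar \<Omega> b v w"
  using assms unfolding bstar_def matrix_vector_mult_diff_distrib
  by (simp add: l2_inner_diff_left bstar_integrand_L2 H1_L2 algebra_simps)

text \<open>The second argument occurs in \<open>bstar\<close> both undifferentiated, where
  differences split pointwise, and through the chosen gradient, where they split only almost
  everywhere.\<close>

lemma bstar_diff_middle:
  assumes a: "continuous_on (closure \<Omega>) a" and v: "v \<in> H1 \<Omega>" "v' \<in> H1 \<Omega>" and w: "w \<in> H1 \<Omega>"
  shows "bstar \<Omega> a (\<lambda>x. v x - v' x) w = bstar \<Omega> a v w - bstar \<Omega> a v' w"
proof -
  note L2 = bstar_integrand_L2[OF _ a] H1_L2
  have "l2_inner \<Omega> (\<lambda>x. grad \<Omega> (\<lambda>x. v x - v' x) x *v a x) w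
      = l2_inner \<Omega> (\<lambda>x. grad \<Omega> v x *v a x - grad \<Omega> v' x *v a x) w"
  proof (rule l2_inner_cong_AE)
    show "AE x in lebesgue_on \<Omega>. grad \<Omega> (\<lambda>x. v x - v' x) x *v a x = grad \<Omega> v x *v a x - grad \<Omega> v' x *v a x"
      using grad_diff[OF v] by eventually_elim (simp add: matrix_vector_mult_diff_rdistrib)
  qed (intro L2_diff L2 H1_diff v w AE_I2 refl)+
  then show ?thesis
    using v w by (simp add: bstar_def l2_inner_diff_left l2_inner_diff_right L2 algebra_simps)
qed

lemma bstar_self: "bstar \<Omega> a v v = 0"
  by (simp add: bstar_def)

section \<open>Differences in the finite element spaces\<close>

lemma polynomial_deg_le_diff:
  assumes "polynomial_deg_le k P" "polynomial_deg_le k Q"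
  shows "polynomial_deg_le k (\<lambda>x. P x - Q x)"
proof -
  obtain c d where
    "\<And>x. P x = (\<Sum>\<alpha> | (\<Sum>i\<in>UNIV. \<alpha> i) \<le> k. c \<alpha> * (\<Prod>i\<in>UNIV. (x $ i) ^ \<alpha> i))"
    "\<And>x. Q x = (\<Sum>\<alpha> | (\<Sum>i\<in>UNIV. \<alpha> i) \<le> k. d \<alpha> * (\<Prod>i\<in>UNIV. (x $ i) ^ \<alpha> i))"
    using assms unfolding polynomial_deg_le_def by blast
  then show ?thesis unfolding polynomial_deg_le_def
    by (intro exI[of _ "\<lambda>\<alpha>. c \<alpha> - d \<alpha>"]) (simp add: left_diff_distrib sum_subtractf)
qed

lemma Xh_H1: "v \<in> Xh \<Omega> \<tau> k \<Longrightarrow> v \<in> H1 \<Omega>"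
  by (simp add: Xh_def H10_def)

lemma Xh_diff:
  assumes v: "v \<in> Xh \<Omega> \<tau> k" and w: "w \<in> Xh \<Omega> \<tau> k"
  shows "(\<lambda>x. v x - w x) \<in> Xh \<Omega> \<tau> k"
  unfolding Xh_def
proof (intro CollectI conjI ballI allI)
  show "(\<lambda>x. v x - w x) \<in> H10 \<Omega>" using v w by (intro H10_diff) (auto simp: Xh_def)
  show "continuous_on (closure \<Omega>) (\<lambda>x. v x - w x)"
    using v w by (intro continuous_on_diff) (auto simp: Xh_def)
  fix T i assume T: "T \<in> \<tau>"
  have "\<exists>P. polynomial_deg_le k P \<and> (\<forall>x\<in>T. v x $ i = P x)"
    using v T unfolding Xh_def by simp
  then obtain P where P: "polynomial_deg_le k P" "\<forall>x\<in>T. v x $ i = P x" by blast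
  have "\<exists>Q. polynomial_deg_le k Q \<and> (\<forall>x\<in>T. w x $ i = Q x)"
    using w T unfolding Xh_def by simp
  then obtain Q where Q: "polynomial_deg_le k Q" "\<forall>x\<in>T. w x $ i = Q x" by blast
  from P Q show "\<exists>P. polynomial_deg_le k P \<and> (\<forall>x\<in>T. (v x - w x) $ i = P x)"
    by (intro exI[of _ "\<lambda>x. P x - Q x"]) (auto intro: polynomial_deg_le_diff)
qed

lemma Qh_L2: "q \<in> Qh \<Omega> \<tau> k \<Longrightarrow> q \<in> L2 \<Omega>"
  by (simp add: Qh_def L20_def)

text \<open>This relies on \<open>Qh\<close> containing all representatives: the divergence of a
  difference agrees with the difference of divergences only almost everywhere.\<close>

lemma Qh_diff:
  assumes p: "p \<in> Qh \<Omega> \<tau> k" and q: "q \<in> Qh \<Omega> \<tau> k"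
  shows "(\<lambda>x. p x - q x) \<in> Qh \<Omega> \<tau> k"
proof -
  obtain v where v: "v \<in> Xh \<Omega> \<tau> k" "AE x in lebesgue_on \<Omega>. p x = divg \<Omega> v x"
    using p unfolding Qh_def by blast
  obtain w where w: "w \<in> Xh \<Omega> \<tau> k" "AE x in lebesgue_on \<Omega>. q x = divg \<Omega> w x"
    using q unfolding Qh_def by blast
  have "AE x in lebesgue_on \<Omega>. p x - q x = divg \<Omega> (\<lambda>x. v x - w x) x"
    using v(2) w(2) divg_diff[OF Xh_H1[OF v(1)] Xh_H1[OF w(1)]] by eventually_elim simp
  moreover have "(LINT x|lebesgue_on \<Omega>. p x) = 0" "(LINT x|lebesgue_on \<Omega>. q x) = 0"
    using p q by (simp_all add: L20_def Qh_def)
  then have "(\<lambda>x. p x - q x) \<in> L20 \<Omega>"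
    using L2_integrable[OF Qh_L2[OF p]] L2_integrable[OF Qh_L2[OF q]]
      L2_diff[OF Qh_L2[OF p] Qh_L2[OF q]] by (simp add: L20_def)
  ultimately show ?thesis using Xh_diff[OF v(1) w(1)] unfolding Qh_def
    by (intro CollectI conjI bexI)
qed

end

subsection \<open>Stability and Lipschitz continuity\<close>

lemma conforming_mesh_bounded:
  assumes "conforming_simplicial_mesh \<Omega> \<tau>"
  shows "bounded \<Omega>"
proof -
  have "finite \<tau>" "\<And>T. T \<in> \<tau> \<Longrightarrow> compact T" "\<Union>\<tau> = closure \<Omega>"
    using assms compact_simplex unfolding conforming_simplicial_mesh_def triangulation_def by blast+
  then have "bounded (closure \<Omega>)"
    by (metis bounded_Union compact_imp_bounded)
  then show ?thesis using bounded_subset closure_subset by blast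
qed

text \<open>Solves an energy inequality for the velocity norm \<open>a\<close>. Completing the
  square in \<open>b\<close> absorbs the pressure and leaves
  \<open>\<nu> * a^2 \<le> N * a + \<epsilon> * P^2 / 4\<close>; for \<open>a\<close> beyond the
  claimed bound the left side would outgrow the right.\<close>

lemma quadratic_bound:
  fixes \<nu> \<epsilon> a b N P :: real
  assumes pos: "0 < \<nu>" "0 < \<epsilon>" and nonneg: "0 \<le> N" "0 \<le> P"
    and le: "\<nu> * a\<^sup>2 + \<epsilon> * b\<^sup>2 \<le> N * a + \<epsilon> * (P * b)"
  shows "a \<le> N / \<nu> + sqrt (\<epsilon> / \<nu>) * P"
proof (rule ccontr)
  let ?A = "N / \<nu>" and ?B = "sqrt (\<epsilon> / \<nu>) * P"
  assume "\<not> a \<le> ?A + ?B"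
  then have a: "?A + ?B < a" by simp
  have A: "0 \<le> ?A" and B: "0 \<le> ?B" using pos nonneg by auto
  have B2: "?B\<^sup>2 = \<epsilon> / \<nu> * P\<^sup>2" using pos by (simp add: power_mult_distrib)
  have "0 \<le> \<epsilon> * (b - P / 2)\<^sup>2" using pos by simp
  then have "\<epsilon> * (P * b) \<le> \<epsilon> * b\<^sup>2 + \<epsilon> * P\<^sup>2 / 4"
    by (simp add: power2_eq_square algebra_simps)
  then have "\<nu> * a\<^sup>2 \<le> N * a + \<epsilon> * P\<^sup>2 / 4" using le by linarith
  also have "\<dots> = \<nu> * (?A * a + ?B\<^sup>2 / 4)"
    using pos unfolding B2 by (simp add: field_simps)
  finally have "a\<^sup>2 \<le> ?A * a + ?B\<^sup>2 / 4" using pos by (simp only: mult_le_cancel_left_pos)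
  \<comment> \<open>The factor 1/4 is given away, so that the bound is a plain sum instead of the
    root of a quadratic.\<close>
  also have "\<dots> \<le> ?A * a + ?B * ?B"
    using zero_le_power2[of ?B] unfolding power2_eq_square[symmetric] by linarith
  also have "\<dots> \<le> ?A * a + ?B * a"
    using a A B by (intro add_left_mono mult_left_mono) linarith+
  also have "\<dots> = (?A + ?B) * a" by (simp add: distrib_right)
  also have "\<dots> < a * a" using a A B by (intro mult_strict_right_mono) linarith+
  finally show False by (simp add: power2_eq_square)
qed

text \<open>Cauchy-Schwarz in the plane with weights \<open>\<nu>\<close> and
  \<open>\<epsilon>\<close>, followed by cancelling one factor of the left-hand norm; if that norm
  is zero the claim is trivial.\<close>

lemma weighted_norm_contraction:
  fixes \<nu> \<epsilon> c d r e s :: real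
  assumes pos: "0 < \<nu>" "0 < \<epsilon>" and c: "0 \<le> c"
    and le: "\<nu> * e\<^sup>2 + \<epsilon> * s\<^sup>2 \<le> c * (\<nu> * (d * e) + \<epsilon> * (r * s))"
  shows "sqrt (\<nu> * e\<^sup>2 + \<epsilon> * s\<^sup>2) \<le> c * sqrt (\<nu> * d\<^sup>2 + \<epsilon> * r\<^sup>2)"
proof -
  let ?S = "\<nu> * e\<^sup>2 + \<epsilon> * s\<^sup>2" and ?T = "\<nu> * d\<^sup>2 + \<epsilon> * r\<^sup>2"
  have S: "0 \<le> ?S" and T: "0 \<le> ?T" using pos by simp_all
  \<comment> \<open>Lagrange's identity for the weighted inner product.\<close>
  have "?T * ?S - (\<nu> * (d * e) + \<epsilon> * (r * s))\<^sup>2 = \<nu> * \<epsilon> * (d * s - r * e)\<^sup>2"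
    by (simp add: power2_eq_square algebra_simps)
  moreover have "0 \<le> \<nu> * \<epsilon> * (d * s - r * e)\<^sup>2" using pos by simp
  ultimately have "(\<nu> * (d * e) + \<epsilon> * (r * s))\<^sup>2 \<le> ?T * ?S" by linarith
  then have "\<nu> * (d * e) + \<epsilon> * (r * s) \<le> sqrt (?T * ?S)" by (rule real_le_rsqrt)
  then have "?S \<le> c * (sqrt ?T * sqrt ?S)"
    using le mult_left_mono[OF _ c] unfolding real_sqrt_mult by (meson order_trans)
  then have "sqrt ?S * sqrt ?S \<le> (c * sqrt ?T) * sqrt ?S" using S by simp
  moreover have "0 \<le> c * sqrt ?T" using c T by simp
  ultimately show ?thesis
    using real_sqrt_ge_zero[OF S] mult_right_le_imp_le less_eq_real_def by metis
qed

context bounded_open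
begin

lemma Xh_H10: "v \<in> Xh \<Omega> \<tau> k \<Longrightarrow> v \<in> H10 \<Omega>"
  by (simp add: Xh_def)

lemma Xh_continuous: "v \<in> Xh \<Omega> \<tau> k \<Longrightarrow> continuous_on (closure \<Omega>) v"
  by (simp add: Xh_def)

text \<open>In the sum of the two tested equations the pressure-divergence terms cancel and
  \<open>bstar\<close> vanishes by skew symmetry, leaving the energy inequality of
  \<open>quadratic_bound\<close> with \<open>dual_norm\<close> as \<open>N\<close>.\<close>

lemma picard_stability:
  assumes pos: "0 < \<nu>" "0 < \<epsilon>" and f: "f \<in> H10_dual \<Omega>"
    and g: "g \<in> Xh \<Omega> \<tau> k" and s: "s \<in> Qh \<Omega> \<tau> k" and p: "p \<in> Qh \<Omega> \<tau> k"
    and momentum: "\<nu> * l2_inner \<Omega> (grad \<Omega> g) (grad \<Omega> g) + bstar \<Omega> u g g - l2_inner \<Omega> s (divg \<Omega> g) = f g"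
    and continuity: "\<epsilon> * l2_inner \<Omega> s s + l2_inner \<Omega> (divg \<Omega> g) s = \<epsilon> * l2_inner \<Omega> p s"
  shows "l2_norm \<Omega> (grad \<Omega> g) \<le> dual_norm \<Omega> f / \<nu> + sqrt (\<epsilon> / \<nu>) * l2_norm \<Omega> p"
proof (rule quadratic_bound[OF pos])
  have "\<nu> * (l2_norm \<Omega> (grad \<Omega> g))\<^sup>2 + \<epsilon> * (l2_norm \<Omega> s)\<^sup>2 = f g + \<epsilon> * l2_inner \<Omega> p s"
    using momentum continuity by (simp add: l2_norm_square bstar_self l2_inner_commute[of \<Omega> s "divg \<Omega> g"])
  also have "\<dots> \<le> dual_norm \<Omega> f * l2_norm \<Omega> (grad \<Omega> g) + \<epsilon> * (l2_norm \<Omega> p * l2_norm \<Omega> s)"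
    using dual_norm_bound(1)[OF f Xh_H10[OF g]] pos(2)
      abs_le_D1[OF l2_inner_Cauchy_Schwarz[OF Qh_L2[OF p] Qh_L2[OF s]]]
    by (intro add_mono mult_left_mono) auto
  finally show "\<nu> * (l2_norm \<Omega> (grad \<Omega> g))\<^sup>2 + \<epsilon> * (l2_norm \<Omega> s)\<^sup>2
      \<le> dual_norm \<Omega> f * l2_norm \<Omega> (grad \<Omega> g) + \<epsilon> * (l2_norm \<Omega> p * l2_norm \<Omega> s)" .
qed (use dual_norm_bound(2)[OF f Xh_H10[OF g]] l2_norm_nonneg in auto)

text \<open>Testing the difference of the two systems with the difference of their solutions leaves only
  the linearization error \<open>bstar \<Omega> (u - w) g e\<close>, since \<open>bstar \<Omega> w e e = 0\<close>.\<close>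

lemma picard_difference_energy:
  assumes u: "u \<in> Xh \<Omega> \<tau> k" and w: "w \<in> Xh \<Omega> \<tau> k" and p: "p \<in> Qh \<Omega> \<tau> k" and z: "z \<in> Qh \<Omega> \<tau> k"
    and g: "g \<in> Xh \<Omega> \<tau> k" and h: "h \<in> Xh \<Omega> \<tau> k" and s: "s \<in> Qh \<Omega> \<tau> k" and t: "t \<in> Qh \<Omega> \<tau> k"
    and momentum: "\<And>v. v \<in> Xh \<Omega> \<tau> k \<Longrightarrow>
      \<nu> * l2_inner \<Omega> (grad \<Omega> g) (grad \<Omega> v) + bstar \<Omega> u g v - l2_inner \<Omega> s (divg \<Omega> v) =
      \<nu> * l2_inner \<Omega> (grad \<Omega> h) (grad \<Omega> v) + bstar \<Omega> w h v - l2_inner \<Omega> t (divg \<Omega> v)"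
    and continuity1: "\<And>q. q \<in> Qh \<Omega> \<tau> k \<Longrightarrow>
      \<epsilon> * l2_inner \<Omega> s q + l2_inner \<Omega> (divg \<Omega> g) q = \<epsilon> * l2_inner \<Omega> p q"
    and continuity2: "\<And>q. q \<in> Qh \<Omega> \<tau> k \<Longrightarrow>
      \<epsilon> * l2_inner \<Omega> t q + l2_inner \<Omega> (divg \<Omega> h) q = \<epsilon> * l2_inner \<Omega> z q"
  shows "\<nu> * (l2_norm \<Omega> (grad \<Omega> (\<lambda>x. g x - h x)))\<^sup>2 + \<epsilon> * (l2_norm \<Omega> (\<lambda>x. s x - t x))\<^sup>2
    = bstar \<Omega> (\<lambda>x. w x - u x) g (\<lambda>x. g x - h x) + \<epsilon> * l2_inner \<Omega> (\<lambda>x. p x - z x) (\<lambda>x. s x - t x)"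
proof -
  let ?e = "\<lambda>x. g x - h x" and ?s = "\<lambda>x. s x - t x"
  have e: "?e \<in> Xh \<Omega> \<tau> k" and q: "?s \<in> Qh \<Omega> \<tau> k" using Xh_diff[OF g h] Qh_diff[OF s t] .
  have eH: "?e \<in> H1 \<Omega>" and gH: "g \<in> H1 \<Omega>" and hH: "h \<in> H1 \<Omega>" using e g h by (auto intro: Xh_H1)
  note L2 = Qh_L2[OF s] Qh_L2[OF t] Qh_L2[OF q] Qh_L2[OF p] Qh_L2[OF z] grad_L2[OF eH] grad_L2[OF gH]
    grad_L2[OF hH] divg_L2[OF eH] divg_L2[OF gH] divg_L2[OF hH]
  have grad: "l2_inner \<Omega> (grad \<Omega> ?e) (grad \<Omega> ?e) =
      l2_inner \<Omega> (grad \<Omega> g) (grad \<Omega> ?e) - l2_inner \<Omega> (grad \<Omega> h) (grad \<Omega> ?e)"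
    unfolding l2_inner_diff_left[OF grad_L2[OF gH] grad_L2[OF hH] grad_L2[OF eH], symmetric]
    by (intro l2_inner_cong_AE grad_diff gH hH L2_diff L2 AE_I2 refl)
  have div: "l2_inner \<Omega> (divg \<Omega> ?e) ?s = l2_inner \<Omega> (divg \<Omega> g) ?s - l2_inner \<Omega> (divg \<Omega> h) ?s"
    unfolding l2_inner_diff_left[OF divg_L2[OF gH] divg_L2[OF hH] Qh_L2[OF q], symmetric]
    by (intro l2_inner_cong_AE divg_diff gH hH L2_diff L2 AE_I2 refl)
  have pres: "l2_inner \<Omega> ?s (divg \<Omega> ?e) = l2_inner \<Omega> s (divg \<Omega> ?e) - l2_inner \<Omega> t (divg \<Omega> ?e)"
    by (intro l2_inner_diff_left L2)
  have ss: "l2_inner \<Omega> ?s ?s = l2_inner \<Omega> s ?s - l2_inner \<Omega> t ?s"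
    by (intro l2_inner_diff_left L2)
  have pz: "l2_inner \<Omega> (\<lambda>x. p x - z x) ?s = l2_inner \<Omega> p ?s - l2_inner \<Omega> z ?s"
    by (intro l2_inner_diff_left L2)
  have b1: "bstar \<Omega> (\<lambda>x. w x - u x) g ?e = bstar \<Omega> w g ?e - bstar \<Omega> u g ?e"
    by (intro bstar_diff_left Xh_continuous[OF w] Xh_continuous[OF u] gH eH)
  \<comment> \<open>Allows \<open>h\<close> to be exchanged for \<open>g\<close> in the convection
    term with velocity \<open>w\<close>. Both convection terms then contain \<open>g\<close>, and
    moving them to the right-hand side produces \<open>w x - u x\<close>.\<close>
  have b2: "0 = bstar \<Omega> w g ?e - bstar \<Omega> w h ?e"
    using bstar_diff_middle[OF Xh_continuous[OF w] gH hH eH] bstar_self by simp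
  show ?thesis
    unfolding l2_norm_square grad ss pz b1 right_diff_distrib
    using momentum[OF e] continuity1[OF q] continuity2[OF q] b2 pres div
      l2_inner_commute[of \<Omega> ?s "divg \<Omega> ?e"] by argo
qed

end

theorem lemma3p5:
  fixes \<Omega> :: "(real^'n) set" and \<tau> :: "(real^'n) set set" and k :: nat
    and \<sigma> \<nu> \<epsilon> M \<kappa> :: real and f :: "'n vfield \<Rightarrow> real"
    and G :: "'n vfield \<times> 'n sfield \<Rightarrow> 'n vfield \<times> 'n sfield"
    and u w :: "'n vfield" and p z :: "'n sfield"
  assumes "CARD('n) = 2 \<or> CARD('n) = 3"
    and "open \<Omega>" and "connected \<Omega>" and "lipschitz_boundary \<Omega>"
    and "conforming_simplicial_mesh \<Omega> \<tau>" and "shape_regular \<sigma> \<tau>"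
    and "M > 0"
    and "\<And>a b c. a \<in> H10 \<Omega> \<Longrightarrow> b \<in> H10 \<Omega> \<Longrightarrow> c \<in> H10 \<Omega> \<Longrightarrow>
           bstar \<Omega> a b c \<le> M * l2_norm \<Omega> (grad \<Omega> a) * l2_norm \<Omega> (grad \<Omega> b) * l2_norm \<Omega> (grad \<Omega> c)"
    and "\<nu> > 0" and "\<epsilon> > 0" and "f \<in> H10_dual \<Omega>"
    and "\<kappa> = M * dual_norm \<Omega> f / \<nu>^2"
    and "iterated_penalty_picard \<Omega> \<tau> k \<nu> \<epsilon> f G"
    and "u \<in> Xh \<Omega> \<tau> k" and "p \<in> Qh \<Omega> \<tau> k" and "w \<in> Xh \<Omega> \<tau> k" and "z \<in> Qh \<Omega> \<tau> k"
  shows "pair_norm \<Omega> \<nu> \<epsilon> (G (u, p) - G (w, z))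
           \<le> max 1 (\<kappa> + sqrt (\<epsilon> / \<nu>^3) * M * l2_norm \<Omega> p) * pair_norm \<Omega> \<nu> \<epsilon> ((u, p) - (w, z))"
proof -
  interpret bounded_open \<Omega>
    using assms(2) conforming_mesh_bounded[OF assms(5)] by unfold_locales
  note M = assms(7) and bstar_le = assms(8) and pos = assms(9,10) and f = assms(11)
    and u = assms(14) and p = assms(15) and w = assms(16) and z = assms(17)
  obtain g s where G1: "G (u, p) = (g, s)" by fastforce
  obtain h t where G2: "G (w, z) = (h, t)" by fastforce
  have gs: "g \<in> Xh \<Omega> \<tau> k" "s \<in> Qh \<Omega> \<tau> k" and ht: "h \<in> Xh \<Omega> \<tau> k" "t \<in> Qh \<Omega> \<tau> k"
    using assms(13) u p w z G1 G2 unfolding iterated_penalty_picard_def by force+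
  have eq1: "\<nu> * l2_inner \<Omega> (grad \<Omega> g) (grad \<Omega> v) + bstar \<Omega> u g v - l2_inner \<Omega> s (divg \<Omega> v) = f v"
      "\<epsilon> * l2_inner \<Omega> s q + l2_inner \<Omega> (divg \<Omega> g) q = \<epsilon> * l2_inner \<Omega> p q"
    if "v \<in> Xh \<Omega> \<tau> k" "q \<in> Qh \<Omega> \<tau> k" for v q
    using assms(13) u p G1 that unfolding iterated_penalty_picard_def by (metis fst_conv snd_conv)+
  have eq2: "\<nu> * l2_inner \<Omega> (grad \<Omega> h) (grad \<Omega> v) + bstar \<Omega> w h v - l2_inner \<Omega> t (divg \<Omega> v) = f v"
      "\<epsilon> * l2_inner \<Omega> t q + l2_inner \<Omega> (divg \<Omega> h) q = \<epsilon> * l2_inner \<Omega> z q"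
    if "v \<in> Xh \<Omega> \<tau> k" "q \<in> Qh \<Omega> \<tau> k" for v q
    using assms(13) w z G2 that unfolding iterated_penalty_picard_def by (metis fst_conv snd_conv)+
  define e where "e = (\<lambda>x. g x - h x)"
  define r where "r = (\<lambda>x. s x - t x)"
  let ?ne = "l2_norm \<Omega> (grad \<Omega> e)" and ?nr = "l2_norm \<Omega> r" and ?ng = "l2_norm \<Omega> (grad \<Omega> g)"
  let ?nu = "l2_norm \<Omega> (grad \<Omega> (\<lambda>x. u x - w x))" and ?np = "l2_norm \<Omega> (\<lambda>x. p x - z x)"
  define c where "c = max 1 (\<kappa> + sqrt (\<epsilon> / \<nu>^3) * M * l2_norm \<Omega> p)"
  have "?ng \<le> dual_norm \<Omega> f / \<nu> + sqrt (\<epsilon> / \<nu>) * l2_norm \<Omega> p"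
    by (rule picard_stability[OF pos f gs p eq1(1)[OF gs] eq1(2)[OF gs]])
  then have "M * ?ng / \<nu> \<le> M * (dual_norm \<Omega> f / \<nu> + sqrt (\<epsilon> / \<nu>) * l2_norm \<Omega> p) / \<nu>"
    using M pos by (intro divide_right_mono mult_left_mono) auto
  also have "\<dots> = \<kappa> + sqrt (\<epsilon> / \<nu>^3) * M * l2_norm \<Omega> p"
  proof -
    \<comment> \<open>The extra division by \<open>\<nu>\<close>, taken under the root as its
      square, turns the \<open>\<epsilon> / \<nu>\<close> of the stability bound into the
      \<open>\<epsilon> / \<nu>^3\<close> of the constant.\<close>
    have "sqrt (\<epsilon> / \<nu>^3) = sqrt (\<epsilon> / \<nu> / \<nu>\<^sup>2)" by (simp add: power3_eq_cube power2_eq_square)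
    also have "\<dots> = sqrt (\<epsilon> / \<nu>) / \<nu>" using pos by (simp only: real_sqrt_divide[of _ "\<nu>\<^sup>2"] real_sqrt_abs abs_of_pos)
    finally have sq: "sqrt (\<epsilon> / \<nu>^3) = sqrt (\<epsilon> / \<nu>) / \<nu>" .
    show ?thesis unfolding sq assms(12) by (simp add: add_divide_distrib distrib_left power2_eq_square)
  qed
  finally have "M * ?ng / \<nu> \<le> c" unfolding c_def by simp
  then have Mg: "M * ?ng \<le> c * \<nu>" using pos by (simp add: divide_le_eq)
  \<comment> \<open>The energy identity contains \<open>w - u\<close>, the target norm
    \<open>u - w\<close>. As chosen gradients respect differences only almost everywhere, the
    passage is made at the level of norms.\<close>
  have diff_wu: "l2_norm \<Omega> (grad \<Omega> (\<lambda>x. w x - u x)) = ?nu"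
    using l2_norm_diff_commute by (simp add: l2_norm_grad_diff Xh_H1[OF u] Xh_H1[OF w])
  have eX: "e \<in> Xh \<Omega> \<tau> k" and rQ: "r \<in> Qh \<Omega> \<tau> k"
    unfolding e_def r_def using Xh_diff[OF gs(1) ht(1)] Qh_diff[OF gs(2) ht(2)] .
  have "\<nu> * ?ne\<^sup>2 + \<epsilon> * ?nr\<^sup>2 = bstar \<Omega> (\<lambda>x. w x - u x) g e + \<epsilon> * l2_inner \<Omega> (\<lambda>x. p x - z x) r"
    unfolding e_def r_def
  proof (rule picard_difference_energy[OF u w p z gs(1) ht(1) gs(2) ht(2)])
    \<comment> \<open>Both right-hand sides are \<open>f v\<close>. The two equations of a system
      come with a joint pair of test functions, so \<open>p\<close> merely fills the pressure
      slot.\<close>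
    show "\<nu> * l2_inner \<Omega> (grad \<Omega> g) (grad \<Omega> v) + bstar \<Omega> u g v - l2_inner \<Omega> s (divg \<Omega> v) =
      \<nu> * l2_inner \<Omega> (grad \<Omega> h) (grad \<Omega> v) + bstar \<Omega> w h v - l2_inner \<Omega> t (divg \<Omega> v)"
      if "v \<in> Xh \<Omega> \<tau> k" for v
      using eq1(1)[OF that p] eq2(1)[OF that p] by simp
  qed (use eq1(2)[OF gs(1)] eq2(2)[OF gs(1)] in auto)
  also have "\<dots> \<le> c * \<nu> * (?nu * ?ne) + \<epsilon> * (?np * ?nr)"
  proof (rule add_mono)
    have "bstar \<Omega> (\<lambda>x. w x - u x) g e \<le> M * ?nu * ?ng * ?ne"
      using bstar_le[OF H10_diff[OF Xh_H10[OF w] Xh_H10[OF u]] Xh_H10[OF gs(1)] Xh_H10[OF eX]]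
      by (simp only: diff_wu)
    also have "\<dots> = (M * ?ng) * (?nu * ?ne)" by simp
    also have "\<dots> \<le> c * \<nu> * (?nu * ?ne)"
      by (intro mult_right_mono Mg mult_nonneg_nonneg l2_norm_nonneg)
    finally show "bstar \<Omega> (\<lambda>x. w x - u x) g e \<le> c * \<nu> * (?nu * ?ne)" .
    show "\<epsilon> * l2_inner \<Omega> (\<lambda>x. p x - z x) r \<le> \<epsilon> * (?np * ?nr)"
      using abs_le_D1[OF l2_inner_Cauchy_Schwarz[OF Qh_L2[OF Qh_diff[OF p z]] Qh_L2[OF rQ]]] pos
      by (intro mult_left_mono) auto
  qed
  \<comment> \<open>The pressure part has factor 1; the entry 1 in the maximum lets it share the
    common factor \<open>c\<close> with the velocity part.\<close>
  also have "\<dots> \<le> c * \<nu> * (?nu * ?ne) + c * (\<epsilon> * (?np * ?nr))"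
  proof -
    have "1 \<le> c" by (simp add: c_def)
    moreover have "0 \<le> \<epsilon> * (?np * ?nr)" using pos(2) by (simp add: mult_nonneg_nonneg l2_norm_nonneg)
    ultimately have "1 * (\<epsilon> * (?np * ?nr)) \<le> c * (\<epsilon> * (?np * ?nr))" by (rule mult_right_mono)
    then show ?thesis by simp
  qed
  finally have "\<nu> * ?ne\<^sup>2 + \<epsilon> * ?nr\<^sup>2 \<le> c * (\<nu> * (?nu * ?ne) + \<epsilon> * (?np * ?nr))"
    by (simp only: distrib_left mult.assoc)
  then have "sqrt (\<nu> * ?ne\<^sup>2 + \<epsilon> * ?nr\<^sup>2) \<le> c * sqrt (\<nu> * ?nu\<^sup>2 + \<epsilon> * ?np\<^sup>2)"
    by (intro weighted_norm_contraction pos) (auto simp: c_def)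
  then show ?thesis
    unfolding c_def G1 G2 pair_norm_def e_def r_def minus_prod_def fun_diff_def by simp
qed

end
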